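(* Let $p\in P^{Log}$ and $k\in\mathbb{N}$. There is a constant $C>0$ depending only on $p$ and $k$ such that for every $r\in\mathbb{N}$ with $r\ge\frac12(k+2)$, every $\sigma>0$ and every $f\in L^{p(\cdot)}$, the Bernstein singular integral $D_{\sigma,k}f$ (formed with the parameter $r$) satisfies $$\|D_{\sigma,k}f\|_{p(\cdot)}\le C\,\|f\|_{p(\cdot)}.$$
   Context: $P$ is the class of measurable functions $p:\mathbb{R}\to[1,\infty)$ with $1\le \operatorname{ess\,inf}_{x\in\mathbb{R}}p(x)$ and $\operatorname{ess\,sup}_{x\in\mathbb{R}}p(x)<\infty$. $P^{Log}$ is the class of $p\in P$ for which there exist constants $c_1,c_2>0$ and $c_3\in\mathbb{R}$ with $|p(x)-p(y)|\ln(e+1/|x-y|)\le c_1$ for all $x,y\in\mathbb{R}$ and $|p(x)-c_3|\ln(e+|x|)\le c_2$ for all $x\in\mathbb{R}$. For $p\in P$, $L^{p(\cdot)}=L^{p(\cdot)}(\mathbb{R})$ is the Banach space of measurable $f:\mathbb{R}\to\mathbb{C}$ with $I_{p(\cdot)}(f/\lambda):=\int_{\mathbb{R}}|f(y)/\lambda|^{p(y)}dy<\infty$ for some $\lambda>0$, with norm $\|f\|_{p(\cdot)}=\inf\{\eta>0: I_{p(\cdot)}(f/\eta)<1\}$. $\mathbb{N}=\{1,2,\dots\}$. For $r,k\in\mathbb{N}$ with $r\ge\frac12(k+2)$ and $\sigma>0$ put $g(\sigma,r,x)=\left(\frac1x\sin\frac{\sigma x}{2r}\right)^{2r}$, $G(\sigma,r,k,\zeta)=\sum_{v=1}^k(-1)^{k-v}\frac1v\binom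 kv g\left(\sigma,r,\frac{\zeta}{v}\right)$, $\gamma_{r,\sigma}=\int_{\mathbb{R}}\left(\frac1t\sin\frac{\sigma t}{2r}\right)^{2r}dt$. The Bernstein singular integral is $D_{\sigma,k}f(x):=\frac{(-1)^{k+1}}{\gamma_{r,\sigma}}\int_{\mathbb{R}}f(u)\,G(\sigma,r,k,u-x)\,du$ for measurable complex-valued $f$ with $\int_{\mathbb{R}}\frac{|f(u)|}{1+u^{2r}}du<\infty$. *)

theory Defs
  imports "HOL-Analysis.Analysis" "HOL-Probability.Essential_Supremum"
begin

text \<open>"Measurable" is read as Lebesgue measurable: all measurability and integrals refer to
  \<open>lebesgue\<close>.\<close>

definition essinf :: "'a measure \<Rightarrow> ('a \<Rightarrow> ereal) \<Rightarrow> ereal" where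
  "essinf M f = - esssup M (\<lambda>x. - f x)"

definition exponents :: "(real \<Rightarrow> real) set" where
  "exponents = {p \<in> borel_measurable lebesgue.
     (\<forall>x. 1 \<le> p x) \<and>
     1 \<le> essinf lebesgue (\<lambda>x. ereal (p x)) \<and>
     esssup lebesgue (\<lambda>x. ereal (p x)) < \<infinity>}"

text \<open>For \<open>x = y\<close> the first condition is trivially true: the first factor vanishes, whatever value
  is given to \<open>1 / 0\<close>.\<close>

definition log_exponents :: "(real \<Rightarrow> real) set" where
  "log_exponents = {p \<in> exponents. \<exists>c1>0. \<exists>c2>0. \<exists>c3.
     (\<forall>x y. \<bar>p x - p y\<bar> * ln (exp 1 + 1 / \<bar>x - y\<bar>) \<le> c1) \<and>
     (\<forall>x. \<bar>p x - c3\<bar> * ln (exp 1 + \<bar>x\<bar>) \<le> c2)}"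

definition modular :: "(real \<Rightarrow> real) \<Rightarrow> (real \<Rightarrow> complex) \<Rightarrow> ennreal" where
  "modular p f = (\<integral>\<^sup>+ y. ennreal (cmod (f y) powr p y) \<partial>lebesgue)"

definition Lvar :: "(real \<Rightarrow> real) \<Rightarrow> (real \<Rightarrow> complex) set" where
  "Lvar p = {f \<in> borel_measurable lebesgue.
     \<exists>c::real. 0 < c \<and> modular p (\<lambda>y. f y / of_real c) < \<infinity>}"

text \<open>The Luxemburg norm; the infimum is only meaningful for \<open>f \<in> Lvar p\<close>, since the set may be
  empty otherwise.\<close>

definition Lvar_norm :: "(real \<Rightarrow> real) \<Rightarrow> (real \<Rightarrow> complex) \<Rightarrow> real" where
  "Lvar_norm p f = Inf {\<eta>::real. 0 < \<eta> \<and> modular p (\<lambda>y. f y / of_real \<eta>) < 1}"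

text \<open>The kernel takes the value \<open>0\<close> at the point \<open>x = 0\<close>, where the formula is undefined; it is
  only used under integrals.\<close>

definition bern_g :: "real \<Rightarrow> nat \<Rightarrow> real \<Rightarrow> real" where
  "bern_g \<sigma> r x = (1 / x * sin (\<sigma> * x / (2 * real r))) ^ (2 * r)"

definition bern_G :: "real \<Rightarrow> nat \<Rightarrow> nat \<Rightarrow> real \<Rightarrow> real" where
  "bern_G \<sigma> r k \<zeta> =
     (\<Sum>v=1..k. (-1) ^ (k - v) * (1 / real v) * real (k choose v) * bern_g \<sigma> r (\<zeta> / real v))"

definition bern_gamma :: "nat \<Rightarrow> real \<Rightarrow> real" where
  "bern_gamma r \<sigma> = (LINT t|lebesgue. (1 / t * sin (\<sigma> * t / (2 * real r))) ^ (2 * r))"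

definition bernstein_domain :: "nat \<Rightarrow> (real \<Rightarrow> complex) set" where
  "bernstein_domain r = {f \<in> borel_measurable lebesgue.
     (\<integral>\<^sup>+ u. ennreal (cmod (f u) / (1 + u ^ (2 * r))) \<partial>lebesgue) < \<infinity>}"

definition bernstein :: "nat \<Rightarrow> real \<Rightarrow> nat \<Rightarrow> (real \<Rightarrow> complex) \<Rightarrow> real \<Rightarrow> complex" where
  "bernstein r \<sigma> k f x =
     of_real ((-1) ^ (k + 1) / bern_gamma r \<sigma>) *
       (LINT u|lebesgue. f u * of_real (bern_G \<sigma> r k (u - x)))"

end

theory Submission
  imports Defs
begin

text \<open>The Bernstein kernel, divided by \<open>bern_gamma r \<sigma>\<close>, is dominated by a constant multiple of the Cauchy
  kernel \<open>1 / (h * (1 + (z / h)\<^sup>2))\<close> with \<open>h = 4 * sqrt r / \<sigma>\<close>, and the constant depends on \<open>k\<close> alone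
  (\<open>bern_kernel_le\<close>): the choice of \<open>h\<close> absorbs both parameters, since \<open>(sin t / t)\<^sup>2 \<le> 1 / (1 + t\<^sup>2 / 4)\<close>
  and Bernoulli's inequality give \<open>(sin t / t) ^ (2 * r) \<le> 1 / (1 + r * t\<^sup>2 / 4)\<close>, while the integral of
  \<open>(sin t / t) ^ (2 * r)\<close> is at least of order \<open>1 / sqrt r\<close>. So it suffices to bound convolution with the
  Cauchy kernel on \<open>Lvar p\<close>, uniformly in the scale \<open>h\<close>.

  The exponent may take the value 1, and then the maximal operator is unbounded. But the Cauchy kernel is
  a superposition, with summable weights, of the normalised indicators of the intervals of radius
  \<open>2 ^ j * h\<close>, and Jensen's inequality reduces the problem to a pointwise bound for averages over
  one interval (\<open>box_average_bound\<close>): if \<open>a\<close> has modular at most 1 and \<open>m\<close> is at most half its average over the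
  interval of radius \<open>R\<close> around \<open>x\<close>, then \<open>m powr p x\<close> is at most a constant times
  the average of \<open>a powr p + E\<close> plus \<open>E x\<close>, where \<open>E y = 1 / (1 + y\<^sup>2)\<close>. Averages preserve the integral, so
  integrating over \<open>x\<close> bounds the modular of the convolution.

  The pointwise bound splits \<open>a\<close> at height 1, and each half uses one of the two conditions on \<open>p\<close>.
  The large part has integral at most 1, so its average is at most \<open>1 / (2 * R)\<close>; the local condition
  makes the powers of a number between 1 and \<open>1 / (2 * R)\<close> with exponents \<open>p x\<close> and \<open>p y\<close>, \<open>\<bar>x - y\<bar> \<le> R\<close>,
  comparable, and Jensen's inequality applies with a constant lower bound of \<open>p\<close> on the interval
  (\<open>local_average_bound\<close>). For values in \<open>[0, 1]\<close> the decay condition lets one exchange \<open>p\<close> for its limit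
  at infinity up to the integrable error \<open>E\<close>, and Jensen's inequality applies with that constant exponent
  (\<open>decay_average_bound\<close>).

  Finally, dividing a function by \<open>B + 1\<close> divides its modular by at least \<open>B + 1\<close> because \<open>p \<ge> 1\<close>, which
  turns the modular bound into the norm bound.\<close>

section \<open>Jensen's inequality for powers\<close>

text \<open>Integrate Young's inequality \<open>q * m powr (q - 1) * t \<le> t powr q + (q - 1) * m powr q\<close> at \<open>t = g x\<close>
  against \<open>w\<close>. The mean enters through a finite lower bound \<open>m\<close> because the mean itself may be infinite.\<close>
lemma nn_integral_jensen_powr:
  fixes w g :: "'a \<Rightarrow> real"
  assumes [measurable]: "w \<in> borel_measurable M" "g \<in> borel_measurable M"
    and w: "\<And>x. 0 \<le> w x" and g: "\<And>x. 0 \<le> g x"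
    and w1: "(\<integral>\<^sup>+ x. ennreal (w x) \<partial>M) \<le> 1"
    and q: "1 \<le> q" and m: "0 \<le> m" "ennreal m \<le> (\<integral>\<^sup>+ x. ennreal (w x * g x) \<partial>M)"
  shows "ennreal (m powr q) \<le> (\<integral>\<^sup>+ x. ennreal (w x * g x powr q) \<partial>M)"
proof (cases "m = 0 \<or> (\<integral>\<^sup>+ x. ennreal (w x * g x powr q) \<partial>M) = \<infinity>")
  case True
  then show ?thesis by (auto simp del: not_gr_zero)
next
  case False
  then have m0: "0 < m" using m by auto
  obtain J where J: "0 \<le> J" "(\<integral>\<^sup>+ x. ennreal (w x * g x powr q) \<partial>M) = ennreal J"
    using False by (cases "(\<integral>\<^sup>+ x. ennreal (w x * g x powr q) \<partial>M)") (auto simp: top_ennreal_def)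
  have young: "q * m powr (q - 1) * t \<le> t powr q + (q - 1) * m powr q" if "0 \<le> t" for t
  proof (cases "t = 0")
    case True
    then show ?thesis using q by simp
  next
    case False
    have "(t powr q) powr (1 / q) * (m powr q) powr (1 - 1 / q) \<le> 1 / q * t powr q + (1 - 1 / q) * m powr q"
      using q m0 that False by (intro Youngs_inequality_0) auto
    moreover have "(t powr q) powr (1 / q) = t" "(m powr q) powr (1 - 1 / q) = m powr (q - 1)"
      using q that by (auto simp: powr_powr right_diff_distrib)
    ultimately have "q * (t * m powr (q - 1)) \<le> q * (1 / q * t powr q + (1 - 1 / q) * m powr q)"
      using q by (intro mult_left_mono) auto
    also have "\<dots> = t powr q + (q - 1) * m powr q" using q by (simp add: field_simps)
    finally show ?thesis by (simp add: mult_ac)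
  qed
  let ?c = "q * m powr (q - 1)"
  have "ennreal (?c * m) = ennreal ?c * ennreal m" using q m by (simp add: ennreal_mult)
  also have "\<dots> \<le> ennreal ?c * (\<integral>\<^sup>+ x. ennreal (w x * g x) \<partial>M)"
    using m by (intro mult_left_mono) auto
  also have "\<dots> = (\<integral>\<^sup>+ x. ennreal (w x * (?c * g x)) \<partial>M)"
    using q w g by (subst nn_integral_cmult[symmetric]) (auto simp: ennreal_mult[symmetric] mult_ac)
  also have "\<dots> \<le> (\<integral>\<^sup>+ x. ennreal (w x * g x powr q) + ennreal ((q - 1) * m powr q) * ennreal (w x) \<partial>M)"
  proof (intro nn_integral_mono)
    fix x
    have "w x * (?c * g x) \<le> w x * (g x powr q + (q - 1) * m powr q)"
      using young[OF g] w by (intro mult_left_mono) auto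
    then have "w x * (?c * g x) \<le> w x * g x powr q + (q - 1) * m powr q * w x"
      by (simp add: distrib_left mult.commute)
    then have "ennreal (w x * (?c * g x)) \<le> ennreal (w x * g x powr q + (q - 1) * m powr q * w x)"
      by (rule ennreal_leI)
    then show "ennreal (w x * (?c * g x)) \<le>
        ennreal (w x * g x powr q) + ennreal ((q - 1) * m powr q) * ennreal (w x)"
      using w[of x] q by (simp add: ennreal_mult)
  qed
  also have "\<dots> = ennreal J + ennreal ((q - 1) * m powr q) * (\<integral>\<^sup>+ x. ennreal (w x) \<partial>M)"
    by (subst nn_integral_add) (auto simp: nn_integral_cmult J)
  also have "\<dots> \<le> ennreal J + ennreal ((q - 1) * m powr q) * 1"
    using w1 by (intro add_left_mono mult_left_mono) auto
  also have "\<dots> = ennreal (J + (q - 1) * m powr q)"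
    using J q by simp
  finally have "?c * m \<le> J + (q - 1) * m powr q"
    using J q by (subst (asm) ennreal_le_iff) auto
  moreover have "?c * m = q * m powr q"
    using m0 by (simp add: powr_diff)
  ultimately have "q * m powr q \<le> J + (q - 1) * m powr q" by simp
  then have "m powr q \<le> J" by (simp add: left_diff_distrib)
  then show ?thesis by (simp add: J ennreal_leI)
qed

section \<open>Averages over intervals\<close>

definition box_kernel :: "real \<Rightarrow> real \<Rightarrow> real" where
  "box_kernel R z = (if \<bar>z\<bar> \<le> R then 1 / (2 * R) else 0)"

definition box_average :: "real \<Rightarrow> (real \<Rightarrow> ennreal) \<Rightarrow> real \<Rightarrow> ennreal" where
  "box_average R u x = (\<integral>\<^sup>+ y. ennreal (box_kernel R (y - x)) * u y \<partial>lborel)"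

lemma box_kernel_nonneg [simp]: "0 < R \<Longrightarrow> 0 \<le> box_kernel R z"
  by (simp add: box_kernel_def)

lemma box_kernel_le: "0 < R \<Longrightarrow> box_kernel R z \<le> 1 / (2 * R)"
  by (simp add: box_kernel_def)

lemma box_kernel_measurable [measurable]: "box_kernel R \<in> borel_measurable borel"
  unfolding box_kernel_def by measurable

lemma nn_integral_box_kernel:
  assumes "0 < R"
  shows "(\<integral>\<^sup>+ y. ennreal (box_kernel R (y - x)) \<partial>lborel) = 1"
    and "(\<integral>\<^sup>+ x. ennreal (box_kernel R (y - x)) \<partial>lborel) = 1"
proof -
  have *: "(\<integral>\<^sup>+ y. ennreal (1 / (2 * R)) * indicator {x - R..x + R} y \<partial>lborel) = 1" for x
    using assms by (simp add: nn_integral_cmult_indicator ennreal_mult[symmetric] del: ennreal_1 flip: ennreal_1)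
  have "(\<integral>\<^sup>+ y. ennreal (box_kernel R (y - x)) \<partial>lborel) =
      (\<integral>\<^sup>+ y. ennreal (1 / (2 * R)) * indicator {x - R..x + R} y \<partial>lborel)"
    by (intro nn_integral_cong) (auto simp: box_kernel_def indicator_def)
  then show "(\<integral>\<^sup>+ y. ennreal (box_kernel R (y - x)) \<partial>lborel) = 1" using * by simp
  have "(\<integral>\<^sup>+ x. ennreal (box_kernel R (y - x)) \<partial>lborel) =
      (\<integral>\<^sup>+ x. ennreal (1 / (2 * R)) * indicator {y - R..y + R} x \<partial>lborel)"
    by (intro nn_integral_cong) (auto simp: box_kernel_def indicator_def)
  then show "(\<integral>\<^sup>+ x. ennreal (box_kernel R (y - x)) \<partial>lborel) = 1" using * by simp
qed

lemma box_average_mono: "(\<And>y. u y \<le> v y) \<Longrightarrow> box_average R u x \<le> box_average R v x"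
  unfolding box_average_def by (intro nn_integral_mono mult_left_mono) auto

lemma box_average_add:
  assumes [measurable]: "u \<in> borel_measurable borel" "v \<in> borel_measurable borel"
  shows "box_average R (\<lambda>y. u y + v y) x = box_average R u x + box_average R v x"
  unfolding box_average_def by (subst nn_integral_add[symmetric]) (auto simp: distrib_left)

lemma box_average_cmult:
  assumes [measurable]: "u \<in> borel_measurable borel"
  shows "box_average R (\<lambda>y. c * u y) x = c * box_average R u x"
  unfolding box_average_def by (subst nn_integral_cmult[symmetric]) (auto simp: mult_ac)

lemma box_average_const_one: "0 < R \<Longrightarrow> box_average R (\<lambda>_. 1) x = 1"
  by (simp add: box_average_def nn_integral_box_kernel)

lemma box_average_measurable [measurable]:
  assumes [measurable]: "u \<in> borel_measurable borel"
  shows "box_average R u \<in> borel_measurable borel"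
  unfolding box_average_def by measurable

lemma nn_integral_box_average:
  assumes [measurable]: "u \<in> borel_measurable borel" and "0 < R"
  shows "(\<integral>\<^sup>+ x. box_average R u x \<partial>lborel) = (\<integral>\<^sup>+ y. u y \<partial>lborel)"
proof -
  have "(\<integral>\<^sup>+ x. box_average R u x \<partial>lborel) = (\<integral>\<^sup>+ y. \<integral>\<^sup>+ x. ennreal (box_kernel R (y - x)) * u y \<partial>lborel \<partial>lborel)"
    unfolding box_average_def by (rule lborel_pair.Fubini') measurable
  also have "\<dots> = (\<integral>\<^sup>+ y. u y \<partial>lborel)"
    using assms(2) by (subst nn_integral_multc) (auto simp: nn_integral_box_kernel)
  finally show ?thesis .
qed

lemma box_average_le_nn_integral:
  assumes [measurable]: "u \<in> borel_measurable borel" and "0 < R"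
  shows "box_average R u x \<le> ennreal (1 / (2 * R)) * (\<integral>\<^sup>+ y. u y \<partial>lborel)"
  unfolding box_average_def using assms
  by (subst nn_integral_cmult[symmetric]) (auto intro!: nn_integral_mono mult_right_mono ennreal_leI box_kernel_le)

section \<open>Pointwise bounds for averages under log-Hoelder continuity\<close>

text \<open>If \<open>t\<close> is below \<open>1 / (e + \<bar>y\<bar>)\<^sup>2\<close>, then so is \<open>t powr s\<close>; otherwise \<open>- ln t \<le> 2 * ln (e + \<bar>y\<bar>)\<close>, and the
  assumption on \<open>s - s'\<close> bounds \<open>t powr (s - s')\<close>. The power 2 makes the error term integrable in \<open>y\<close>.\<close>
lemma powr_exchange:
  fixes t s s' :: real
  assumes t: "0 \<le> t" "t \<le> 1" and s: "1 \<le> s" and d: "\<bar>s - s'\<bar> * ln (exp 1 + \<bar>y\<bar>) \<le> c"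
  shows "t powr s \<le> exp (2 * c) * t powr s' + 1 / (1 + y\<^sup>2)"
proof -
  define B where "B = exp 1 + \<bar>y\<bar>"
  have "1 + 1 \<le> (exp 1 :: real)" by (rule exp_ge_add_one_self)
  then have B: "1 < B" "1 + \<bar>y\<bar> \<le> B" by (auto simp: B_def)
  have "1 + y\<^sup>2 \<le> (1 + \<bar>y\<bar>)\<^sup>2" by (simp add: power2_eq_square algebra_simps)
  also have "\<dots> \<le> B\<^sup>2" using B by (intro power_mono) auto
  finally have yB: "1 / B\<^sup>2 \<le> 1 / (1 + y\<^sup>2)"
    using B by (intro divide_left_mono) (auto intro!: mult_pos_pos add_pos_nonneg)
  show ?thesis
  proof (cases "t \<le> 1 / B\<^sup>2")
    case True
    have "t powr s \<le> t powr 1" using t s by (intro powr_mono') auto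
    then show ?thesis using True yB t by (simp add: add_increasing)
  next
    case False
    then have t0: "0 < t" using B by (smt (verit) zero_le_divide_1_iff zero_le_power2)
    have "ln t \<ge> ln (1 / B\<^sup>2)" using False B t0 by (subst ln_le_cancel_iff) auto
    then have "- ln t \<le> 2 * ln B" using B by (simp add: ln_div ln_realpow)
    then have "\<bar>s - s'\<bar> * (- ln t) \<le> \<bar>s - s'\<bar> * (2 * ln B)" by (intro mult_left_mono) auto
    also have "\<dots> \<le> 2 * c" using d by (simp add: B_def)
    finally have *: "\<bar>s - s'\<bar> * (- ln t) \<le> 2 * c" .
    have "(s - s') * ln t \<le> \<bar>s - s'\<bar> * (- ln t)"
      using t t0 abs_ge_self[of "(s - s') * ln t"] by (simp add: abs_mult)
    then have "exp ((s - s') * ln t) \<le> exp (2 * c)" using * by simp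
    then have "t powr (s - s') * t powr s' \<le> exp (2 * c) * t powr s'"
      using t0 by (intro mult_right_mono) (auto simp: powr_def)
    then show ?thesis by (simp add: powr_add[symmetric] add_increasing2)
  qed
qed

lemma le_ennreal_cmult: "1 \<le> c \<Longrightarrow> u \<le> ennreal c * u"
  using mult_right_mono[of 1 "ennreal c" u] by simp

text \<open>Where \<open>a\<close> does not vanish it is at least 1, so lowering the exponent lowers the power. Therefore
  Jensen's inequality may be used with a lower bound \<open>q\<close> of \<open>p\<close> on the interval. For \<open>m > 1\<close>, passing from \<open>m powr q\<close> to
  \<open>m powr p x\<close> costs a bounded factor since \<open>m \<le> 1 / (2 * R)\<close> and \<open>p x - q \<le> c1 / ln (e + 1 / R)\<close>; for \<open>m \<le> 1\<close>
  the exponent 1 will do.\<close>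
lemma local_average_bound:
  fixes p a :: "real \<Rightarrow> real"
  assumes [measurable]: "p \<in> borel_measurable borel" "a \<in> borel_measurable borel"
    and p1: "\<And>x. 1 \<le> p x"
    and c1: "0 < c1" "\<And>x y. \<bar>p x - p y\<bar> * ln (exp 1 + 1 / \<bar>x - y\<bar>) \<le> c1"
    and a: "\<And>y. a y = 0 \<or> 1 \<le> a y"
    and a1: "(\<integral>\<^sup>+ y. ennreal (a y powr p y) \<partial>lborel) \<le> 1"
    and R: "0 < R" and m: "0 \<le> m" "ennreal m \<le> box_average R (\<lambda>y. ennreal (a y)) x"
  shows "ennreal (m powr p x) \<le> ennreal (exp c1) * box_average R (\<lambda>y. ennreal (a y powr p y)) x"
proof -
  have a_nonneg: "0 \<le> a y" for y using a[of y] by auto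
  have a_le: "a y powr q \<le> a y powr p y" if "q \<le> p y" for y q
    using a[of y] that by (auto intro: powr_mono)
  have a_le1: "a y \<le> a y powr p y" for y
    using a_le[of 1 y] p1[of y] a_nonneg by simp
  have m_le: "m \<le> 1 / (2 * R)"
  proof -
    have "ennreal m \<le> ennreal (1 / (2 * R)) * (\<integral>\<^sup>+ y. ennreal (a y) \<partial>lborel)"
      using m R box_average_le_nn_integral[of "\<lambda>y. ennreal (a y)" R x] by (auto intro: order_trans)
    also have "\<dots> \<le> ennreal (1 / (2 * R)) * (\<integral>\<^sup>+ y. ennreal (a y powr p y) \<partial>lborel)"
      by (intro mult_left_mono nn_integral_mono ennreal_leI a_le1) auto
    also have "\<dots> \<le> ennreal (1 / (2 * R)) * 1"
      by (intro mult_left_mono a1) auto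
    finally have "ennreal m \<le> ennreal (1 / (2 * R))" by (simp only: mult_1_right)
    then show ?thesis using R by (subst (asm) ennreal_le_iff) auto
  qed
  show ?thesis
  proof (cases "m \<le> 1")
    case True
    then have "m powr p x \<le> m" using m p1[of x] powr_mono'[of 1 "p x" m] by auto
    then have "ennreal (m powr p x) \<le> box_average R (\<lambda>y. ennreal (a y)) x"
      using m by (meson ennreal_leI order_trans)
    also have "\<dots> \<le> box_average R (\<lambda>y. ennreal (a y powr p y)) x"
      by (intro box_average_mono ennreal_leI a_le1)
    also have "\<dots> \<le> ennreal (exp c1) * box_average R (\<lambda>y. ennreal (a y powr p y)) x"
      using c1 by (intro le_ennreal_cmult) auto
    finally show ?thesis .
  next
    case False
    define L where "L = ln (exp 1 + 1 / R)"
    \<comment> \<open>A lower bound of \<open>p\<close> on the interval that stays in the range of Jensen's inequality.\<close>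
    define q where "q = max 1 (p x - c1 / L)"
    have "1 + 1 \<le> (exp 1 :: real)" by (rule exp_ge_add_one_self)
    then have L0: "0 < L" using R add_strict_mono[of 1 "exp 1" 0 "1 / R"] by (simp add: L_def)
    have q: "q \<le> p y" if "\<bar>y - x\<bar> \<le> R" for y
    proof (cases "y = x")
      case True
      then show ?thesis using p1[of x] c1 L0 by (simp add: q_def)
    next
      case False
      have "L \<le> ln (exp 1 + 1 / \<bar>x - y\<bar>)"
        using False that R unfolding L_def
        by (subst ln_le_cancel_iff) (auto intro!: add_pos_pos divide_left_mono mult_pos_pos)
      then have "\<bar>p x - p y\<bar> * L \<le> \<bar>p x - p y\<bar> * ln (exp 1 + 1 / \<bar>x - y\<bar>)"
        by (intro mult_left_mono) auto
      also have "\<dots> \<le> c1" by (rule c1)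
      finally have "\<bar>p x - p y\<bar> \<le> c1 / L" using L0 by (simp add: field_simps)
      then show ?thesis using p1[of y] by (simp add: q_def)
    qed
    have "m powr p x = m powr (p x - q) * m powr q"
      using m by (simp add: powr_add[symmetric])
    also have "m powr (p x - q) \<le> exp c1"
    proof -
      have "1 / (2 * R) \<le> 1 / R" using R by (intro divide_left_mono) auto
      also have "1 / R \<le> exp 1 + 1 / R" by simp
      finally have "m \<le> exp 1 + 1 / R" using m_le by linarith
      then have "ln m \<le> L" using False R unfolding L_def
        by (subst ln_le_cancel_iff) (auto intro!: add_pos_pos)
      moreover have "0 \<le> ln m" using False by simp
      moreover have "p x - q \<le> c1 / L" "0 \<le> p x - q"
        using q[of x] R by (auto simp: q_def)
      ultimately have "(p x - q) * ln m \<le> c1 / L * L" using c1 L0 by (intro mult_mono) auto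
      then show ?thesis using False L0 by (simp add: powr_def)
    qed
    finally have "m powr p x \<le> exp c1 * m powr q" by (simp add: mult_right_mono)
    then have "ennreal (m powr p x) \<le> ennreal (exp c1) * ennreal (m powr q)"
      by (simp add: ennreal_mult[symmetric] ennreal_leI)
    also have "ennreal (m powr q) \<le> (\<integral>\<^sup>+ y. ennreal (box_kernel R (y - x) * a y powr q) \<partial>lborel)"
      using R m a_nonneg
      by (intro nn_integral_jensen_powr)
         (auto simp: nn_integral_box_kernel q_def box_average_def ennreal_mult)
    also have "\<dots> \<le> box_average R (\<lambda>y. ennreal (a y powr p y)) x"
      unfolding box_average_def
    proof (intro nn_integral_mono)
      fix y
      have "box_kernel R (y - x) * a y powr q \<le> box_kernel R (y - x) * a y powr p y"
        using R q[of y] by (cases "\<bar>y - x\<bar> \<le> R") (auto simp: box_kernel_def intro!: divide_right_mono a_le)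
      then show "ennreal (box_kernel R (y - x) * a y powr q) \<le>
          ennreal (box_kernel R (y - x)) * ennreal (a y powr p y)"
        using R by (simp add: ennreal_mult[symmetric] ennreal_leI)
    qed
    finally show ?thesis by (simp add: mult_left_mono)
  qed
qed

text \<open>The constant exponent \<open>s\<close>, the limit of \<open>p\<close> at infinity, stands between two exchanges of exponents:
  \<open>p x\<close> for \<open>s\<close> at the average, and \<open>s\<close> for \<open>p y\<close> under the average.\<close>
lemma decay_average_bound:
  fixes p a :: "real \<Rightarrow> real"
  assumes [measurable]: "p \<in> borel_measurable borel" "a \<in> borel_measurable borel"
    and p1: "\<And>x. 1 \<le> p x"
    and c: "0 < c" "1 \<le> s" "\<And>x. \<bar>p x - s\<bar> * ln (exp 1 + \<bar>x\<bar>) \<le> c"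
    and a: "\<And>y. 0 \<le> a y" "\<And>y. a y \<le> 1"
    and R: "0 < R" and m: "0 \<le> m" "ennreal m \<le> box_average R (\<lambda>y. ennreal (a y)) x"
  shows "ennreal (m powr p x) \<le> ennreal (exp (4 * c)) *
    (box_average R (\<lambda>y. ennreal (a y powr p y + 1 / (1 + y\<^sup>2))) x + ennreal (1 / (1 + x\<^sup>2)))"
proof -
  have "box_average R (\<lambda>y. ennreal (a y)) x \<le> box_average R (\<lambda>_. 1) x"
    by (intro box_average_mono) (simp add: a)
  then have m1: "m \<le> 1" using m R by (auto simp: box_average_const_one dest: order_trans)
  have js: "ennreal (m powr s) \<le> (\<integral>\<^sup>+ y. ennreal (box_kernel R (y - x) * a y powr s) \<partial>lborel)"
    using R m a c
    by (intro nn_integral_jensen_powr) (auto simp: nn_integral_box_kernel box_average_def ennreal_mult)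
  also have "\<dots> = box_average R (\<lambda>y. ennreal (a y powr s)) x"
    using R by (simp add: box_average_def ennreal_mult)
  also have "\<dots> \<le> box_average R (\<lambda>y. ennreal (exp (2 * c)) * ennreal (a y powr p y + 1 / (1 + y\<^sup>2))) x"
  proof (intro box_average_mono)
    fix y
    have "a y powr s \<le> exp (2 * c) * a y powr p y + 1 / (1 + y\<^sup>2)"
      using a c c(3)[of y] by (intro powr_exchange) (auto simp: abs_minus_commute)
    also have "1 / (1 + y\<^sup>2) \<le> exp (2 * c) * (1 / (1 + y\<^sup>2))"
      using c mult_right_mono[of 1 "exp (2 * c)" "1 / (1 + y\<^sup>2)"] by auto
    finally have "a y powr s \<le> exp (2 * c) * (a y powr p y + 1 / (1 + y\<^sup>2))"
      by (simp only: distrib_left add_left_mono)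
    then show "ennreal (a y powr s) \<le> ennreal (exp (2 * c)) * ennreal (a y powr p y + 1 / (1 + y\<^sup>2))"
      by (subst ennreal_mult[symmetric]) (simp_all add: ennreal_leI del: ennreal_plus)
  qed
  also have "\<dots> = ennreal (exp (2 * c)) * box_average R (\<lambda>y. ennreal (a y powr p y + 1 / (1 + y\<^sup>2))) x"
    by (rule box_average_cmult) measurable
  finally have *: "ennreal (m powr s) \<le>
    ennreal (exp (2 * c)) * box_average R (\<lambda>y. ennreal (a y powr p y + 1 / (1 + y\<^sup>2))) x" .
  have "m powr p x \<le> exp (2 * c) * m powr s + 1 / (1 + x\<^sup>2)"
    using m m1 p1 c by (intro powr_exchange) auto
  then have "ennreal (m powr p x) \<le> ennreal (exp (2 * c)) * ennreal (m powr s) + ennreal (1 / (1 + x\<^sup>2))"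
    by (simp add: ennreal_mult[symmetric] ennreal_plus[symmetric] ennreal_leI del: ennreal_plus)
  also have "\<dots> \<le> ennreal (exp (2 * c)) * (ennreal (exp (2 * c)) *
      box_average R (\<lambda>y. ennreal (a y powr p y + 1 / (1 + y\<^sup>2))) x) + ennreal (exp (4 * c)) * ennreal (1 / (1 + x\<^sup>2))"
    using c by (intro add_mono mult_left_mono * le_ennreal_cmult) auto
  also have "\<dots> = ennreal (exp (4 * c)) *
    (box_average R (\<lambda>y. ennreal (a y powr p y + 1 / (1 + y\<^sup>2))) x + ennreal (1 / (1 + x\<^sup>2)))"
    by (simp add: mult.assoc[symmetric] ennreal_mult[symmetric] exp_add[symmetric] distrib_left)
  finally show ?thesis .
qed

text \<open>The factor 2 in the hypothesis on \<open>m\<close> lets one of the two parts of \<open>a\<close>, above and below height 1,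
  have an average of at least \<open>m\<close>; no constant then has to be raised to the power \<open>p x\<close>.\<close>
lemma box_average_bound:
  fixes p a :: "real \<Rightarrow> real"
  assumes [measurable]: "p \<in> borel_measurable borel" "a \<in> borel_measurable borel"
    and p1: "\<And>x. 1 \<le> p x"
    and c1: "0 < c1" "\<And>x y. \<bar>p x - p y\<bar> * ln (exp 1 + 1 / \<bar>x - y\<bar>) \<le> c1"
    and c: "0 < c" "1 \<le> s" "\<And>x. \<bar>p x - s\<bar> * ln (exp 1 + \<bar>x\<bar>) \<le> c"
    and a: "\<And>y. 0 \<le> a y"
    and a1: "(\<integral>\<^sup>+ y. ennreal (a y powr p y) \<partial>lborel) \<le> 1"
    and R: "0 < R" and m: "0 \<le> m" "ennreal (2 * m) \<le> box_average R (\<lambda>y. ennreal (a y)) x"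
  shows "ennreal (m powr p x) \<le> ennreal (exp (c1 + 4 * c)) *
    (box_average R (\<lambda>y. ennreal (a y powr p y + 1 / (1 + y\<^sup>2))) x + ennreal (1 / (1 + x\<^sup>2)))" (is "_ \<le> ?rhs")
proof -
  define b where "b = (\<lambda>y. if 1 \<le> a y then a y else 0)"
  define d where "d = (\<lambda>y. if 1 \<le> a y then 0 else a y)"
  have [measurable]: "b \<in> borel_measurable borel" "d \<in> borel_measurable borel"
    unfolding b_def d_def by measurable
  have bd: "0 \<le> b y" "0 \<le> d y" "d y \<le> 1" "b y = 0 \<or> 1 \<le> b y" "a y = b y + d y"
    "b y powr p y \<le> a y powr p y" "d y powr p y \<le> a y powr p y" for y
    using a[of y] by (auto simp: b_def d_def)
  have "box_average R (\<lambda>y. ennreal (a y)) x = box_average R (\<lambda>y. ennreal (b y)) x + box_average R (\<lambda>y. ennreal (d y)) x"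
    by (subst box_average_add[symmetric]) (auto simp: bd)
  with m(2) have "ennreal m + ennreal m \<le> box_average R (\<lambda>y. ennreal (b y)) x + box_average R (\<lambda>y. ennreal (d y)) x"
    using m(1) by (simp only: ennreal_plus[symmetric] mult_2)
  then have "ennreal m \<le> box_average R (\<lambda>y. ennreal (b y)) x \<or> ennreal m \<le> box_average R (\<lambda>y. ennreal (d y)) x"
    using add_strict_mono[of _ "ennreal m" _ "ennreal m"] by (meson leD leI)
  then show ?thesis
  proof
    assume mb: "ennreal m \<le> box_average R (\<lambda>y. ennreal (b y)) x"
    have "(\<integral>\<^sup>+ y. ennreal (b y powr p y) \<partial>lborel) \<le> (\<integral>\<^sup>+ y. ennreal (a y powr p y) \<partial>lborel)"
      by (intro nn_integral_mono ennreal_leI bd)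
    then have b1: "(\<integral>\<^sup>+ y. ennreal (b y powr p y) \<partial>lborel) \<le> 1" using a1 by (rule order_trans)
    have "ennreal (m powr p x) \<le> ennreal (exp c1) * box_average R (\<lambda>y. ennreal (b y powr p y)) x"
      by (rule local_average_bound[OF _ _ p1 c1 _ b1 R m(1) mb]) (use bd in auto)
    also have "\<dots> \<le> ennreal (exp (c1 + 4 * c)) * (box_average R (\<lambda>y. ennreal (a y powr p y + 1 / (1 + y\<^sup>2))) x)"
      using c by (intro mult_mono box_average_mono ennreal_leI add_increasing2 bd) auto
    also have "\<dots> \<le> ?rhs" by (intro mult_left_mono) auto
    finally show ?thesis .
  next
    assume md: "ennreal m \<le> box_average R (\<lambda>y. ennreal (d y)) x"
    have "ennreal (m powr p x) \<le> ennreal (exp (4 * c)) *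
      (box_average R (\<lambda>y. ennreal (d y powr p y + 1 / (1 + y\<^sup>2))) x + ennreal (1 / (1 + x\<^sup>2)))"
      by (rule decay_average_bound[OF _ _ p1 c _ _ R m(1) md]) (use bd in auto)
    also have "\<dots> \<le> ?rhs"
      using c1 by (intro mult_mono add_mono box_average_mono ennreal_leI bd) auto
    finally show ?thesis .
  qed
qed

section \<open>Convolution with the Cauchy kernel\<close>

definition cauchy_kernel :: "real \<Rightarrow> real \<Rightarrow> real" where
  "cauchy_kernel h z = 1 / (h * (1 + (z / h)\<^sup>2))"

lemma cauchy_kernel_measurable [measurable]: "cauchy_kernel h \<in> borel_measurable borel"
  unfolding cauchy_kernel_def by measurable

lemma cauchy_kernel_nonneg [simp]: "0 < h \<Longrightarrow> 0 \<le> cauchy_kernel h z"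
  by (simp add: cauchy_kernel_def)

abbreviation dyadic_weight :: "nat \<Rightarrow> real" where
  "dyadic_weight j \<equiv> (1 / 2) ^ Suc j"

lemma suminf_dyadic_weight: "(\<Sum>j. ennreal (dyadic_weight j)) = 1"
  using power_half_series by (subst suminf_ennreal2) (auto simp: sums_iff)

text \<open>For the least \<open>j\<close> with \<open>\<bar>z\<bar> \<le> 2 ^ j * h\<close> the quadratic decay gives a bound of order \<open>4 ^ (- j) / h\<close>,
  and the \<open>j\<close>-th box alone, of height of order \<open>2 ^ (- j) / h\<close> and with weight \<open>2 ^ (- Suc j)\<close>, matches it.\<close>
lemma cauchy_kernel_le_boxes:
  assumes h: "0 < h"
  shows "ennreal (cauchy_kernel h z) \<le>
    ennreal 16 * (\<Sum>j. ennreal (dyadic_weight j) * ennreal (box_kernel (2 ^ j * h) z))"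
proof -
  obtain n :: nat where n: "\<bar>z\<bar> / h < 2 ^ n" using real_arch_pow[of 2] by auto
  then have ex: "\<bar>z\<bar> \<le> 2 ^ n * h" using h by (simp add: field_simps)
  define j where "j = (LEAST j. \<bar>z\<bar> \<le> 2 ^ j * h)"
  have j: "\<bar>z\<bar> \<le> 2 ^ j * h" unfolding j_def by (rule LeastI[where P = "\<lambda>j. \<bar>z\<bar> \<le> 2 ^ j * h", OF ex])
  have main: "cauchy_kernel h z \<le> 16 * (dyadic_weight j * (1 / (2 * (2 ^ j * h))))"
  proof -
    have "4 ^ j \<le> 4 * (1 + (z / h)\<^sup>2)"
    proof (cases j)
      case 0
      have "0 \<le> (z / h)\<^sup>2" by simp
      then show ?thesis unfolding 0 by simp
    next
      case (Suc i)
      have "\<not> \<bar>z\<bar> \<le> 2 ^ i * h"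
        using not_less_Least[of i "\<lambda>j. \<bar>z\<bar> \<le> 2 ^ j * h"] by (simp add: j_def[symmetric] Suc)
      then have "2 ^ i \<le> \<bar>z\<bar> / h" using h by (simp add: field_simps)
      then have "(2 ^ i)\<^sup>2 \<le> (\<bar>z\<bar> / h)\<^sup>2" by (intro power_mono) auto
      moreover have "(2 ^ i)\<^sup>2 = (4 :: real) ^ i"
        by (simp add: power_mult[symmetric] mult.commute[of i] power_mult)
      ultimately show ?thesis by (simp add: Suc power_divide)
    qed
    then have "1 / (1 + (z / h)\<^sup>2) \<le> 4 / 4 ^ j"
      using add_pos_nonneg[of 1 "(z / h)\<^sup>2"] by (simp add: field_simps)
    then have "1 / (1 + (z / h)\<^sup>2) / h \<le> 4 / 4 ^ j / h"
      using h by (intro divide_right_mono) auto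
    also have "4 / 4 ^ j / h = 16 * (dyadic_weight j * (1 / (2 * (2 ^ j * h))))"
    proof -
      have "(4 :: real) ^ j = 2 ^ j * 2 ^ j" by (simp add: power_mult_distrib[symmetric])
      then show ?thesis by (simp add: power_divide field_simps)
    qed
    finally show ?thesis by (simp add: cauchy_kernel_def mult.commute)
  qed
  have "ennreal (cauchy_kernel h z) \<le> ennreal (16 * (dyadic_weight j * box_kernel (2 ^ j * h) z))"
    using main j by (intro ennreal_leI) (simp add: box_kernel_def)
  also have "\<dots> = ennreal 16 * (ennreal (dyadic_weight j) * ennreal (box_kernel (2 ^ j * h) z))"
    using h by (simp only: ennreal_mult' ennreal_mult'' box_kernel_nonneg zero_le_numeral mult_pos_pos
        zero_less_power zero_less_numeral zero_le_power zero_le_divide_1_iff)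
  also have "\<dots> \<le> ennreal 16 * (\<Sum>j. ennreal (dyadic_weight j) * ennreal (box_kernel (2 ^ j * h) z))"
    using sum_le_suminf[of "\<lambda>j. ennreal (dyadic_weight j) * ennreal (box_kernel (2 ^ j * h) z)" "{j}"]
    by (intro mult_left_mono) auto
  finally show ?thesis .
qed

lemma cauchy_integral_le_averages:
  assumes h: "0 < h" and [measurable]: "u \<in> borel_measurable borel"
  shows "(\<integral>\<^sup>+ y. ennreal (cauchy_kernel h (y - x)) * u y \<partial>lborel) \<le>
    ennreal 16 * (\<Sum>j. ennreal (dyadic_weight j) * box_average (2 ^ j * h) u x)"
proof -
  have "(\<integral>\<^sup>+ y. ennreal (cauchy_kernel h (y - x)) * u y \<partial>lborel) \<le>
    (\<integral>\<^sup>+ y. ennreal 16 * (\<Sum>j. ennreal (dyadic_weight j) * (ennreal (box_kernel (2 ^ j * h) (y - x)) * u y)) \<partial>lborel)"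
  proof (intro nn_integral_mono)
    fix y
    have "ennreal (cauchy_kernel h (y - x)) * u y \<le>
      ennreal 16 * (\<Sum>j. ennreal (dyadic_weight j) * ennreal (box_kernel (2 ^ j * h) (y - x))) * u y"
      by (intro mult_right_mono cauchy_kernel_le_boxes h) auto
    then show "ennreal (cauchy_kernel h (y - x)) * u y \<le>
      ennreal 16 * (\<Sum>j. ennreal (dyadic_weight j) * (ennreal (box_kernel (2 ^ j * h) (y - x)) * u y))"
      by (simp only: ennreal_suminf_multc[symmetric] mult.assoc)
  qed
  also have "\<dots> = ennreal 16 * (\<Sum>j. ennreal (dyadic_weight j) * box_average (2 ^ j * h) u x)"
    unfolding box_average_def by (simp add: nn_integral_cmult nn_integral_suminf)
  finally show ?thesis .
qed

lemma nn_integral_cauchy_kernel_le: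
  assumes h: "0 < h"
  shows "(\<integral>\<^sup>+ z. ennreal (cauchy_kernel h z) \<partial>lborel) \<le> 16"
proof -
  have "(\<integral>\<^sup>+ z. ennreal (cauchy_kernel h z) \<partial>lborel) =
      (\<integral>\<^sup>+ z. ennreal (cauchy_kernel h (z - 0)) * 1 \<partial>lborel)" by simp
  also have "\<dots> \<le> ennreal 16 * (\<Sum>j. ennreal (dyadic_weight j) * box_average (2 ^ j * h) (\<lambda>_. 1) 0)"
    by (rule cauchy_integral_le_averages[OF h]) simp
  also have "\<dots> = ennreal 16 * (\<Sum>j. ennreal (dyadic_weight j))"
    using h by (simp only: box_average_const_one mult_pos_pos zero_less_power zero_less_numeral mult_1_right)
  also have "\<dots> = 16"
    by (simp only: suminf_dyadic_weight mult_1_right ennreal_numeral)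
  finally show ?thesis .
qed

lemma integrable_cauchy_kernel:
  assumes h: "0 < h"
  shows "integrable lborel (cauchy_kernel h)"
proof (rule integrableI_bounded)
  have "(\<integral>\<^sup>+ z. ennreal (norm (cauchy_kernel h z)) \<partial>lborel) \<le> 16"
    using nn_integral_cauchy_kernel_le[OF h] h by simp
  also have "(16 :: ennreal) < \<infinity>" by simp
  finally show "(\<integral>\<^sup>+ z. ennreal (norm (cauchy_kernel h z)) \<partial>lborel) < \<infinity>" .
qed measurable

lemma nn_integral_inverse_one_plus_sq_le: "(\<integral>\<^sup>+ z. ennreal (1 / (1 + (z::real)\<^sup>2)) \<partial>lborel) \<le> 16"
  using nn_integral_cauchy_kernel_le[of 1] by (simp add: cauchy_kernel_def)

text \<open>The factor 32 is the total mass 16 of the boxes times the 2 that \<open>box_average_bound\<close> asks for.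
  Jensen's inequality over the scales \<open>j\<close> reduces the claim to single averages, and integrating
  \<open>(a powr p + E) + E\<close> gives at most \<open>(1 + 16) + 16 = 33\<close>.\<close>
lemma cauchy_modular_bound:
  fixes p a m :: "real \<Rightarrow> real"
  assumes [measurable]: "p \<in> borel_measurable borel" "a \<in> borel_measurable borel"
    and p1: "\<And>x. 1 \<le> p x"
    and c1: "0 < c1" "\<And>x y. \<bar>p x - p y\<bar> * ln (exp 1 + 1 / \<bar>x - y\<bar>) \<le> c1"
    and c: "0 < c" "1 \<le> s" "\<And>x. \<bar>p x - s\<bar> * ln (exp 1 + \<bar>x\<bar>) \<le> c"
    and a: "\<And>y. 0 \<le> a y"
    and a1: "(\<integral>\<^sup>+ y. ennreal (a y powr p y) \<partial>lborel) \<le> 1"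
    and h: "0 < h"
    and m: "\<And>x. 0 \<le> m x"
      "\<And>x. ennreal (32 * m x) \<le> (\<integral>\<^sup>+ y. ennreal (cauchy_kernel h (y - x)) * ennreal (a y) \<partial>lborel)"
  shows "(\<integral>\<^sup>+ x. ennreal (m x powr p x) \<partial>lborel) \<le> ennreal (33 * exp (c1 + 4 * c))"
proof -
  define F where "F = (\<lambda>y. ennreal (a y powr p y + 1 / (1 + y\<^sup>2)))"
  define E where "E = (\<lambda>x::real. ennreal (1 / (1 + x\<^sup>2)))"
  define K where "K = ennreal (exp (c1 + 4 * c))"
  have [measurable]: "F \<in> borel_measurable borel" "E \<in> borel_measurable borel"
    unfolding F_def E_def by measurable
  have E: "(\<integral>\<^sup>+ x. E x \<partial>lborel) \<le> 16" unfolding E_def by (rule nn_integral_inverse_one_plus_sq_le)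
  have "(\<integral>\<^sup>+ y. F y \<partial>lborel) = (\<integral>\<^sup>+ y. ennreal (a y powr p y) \<partial>lborel) + (\<integral>\<^sup>+ x. E x \<partial>lborel)"
    unfolding F_def E_def by (subst nn_integral_add[symmetric]) auto
  also have "\<dots> \<le> 1 + 16" using a1 E by (rule add_mono)
  finally have F: "(\<integral>\<^sup>+ y. F y \<partial>lborel) \<le> 1 + 16" .
  have pw: "ennreal (m x powr p x) \<le>
      (\<Sum>j. ennreal (dyadic_weight j) * (K * (box_average (2 ^ j * h) F x + E x)))" for x
  proof -
    \<comment> \<open>The averages are finite, so they can be treated as real numbers.\<close>
    define g where "g = (\<lambda>j::nat. enn2real (box_average (2 ^ j * h) (\<lambda>y. ennreal (a y)) x) / 2)"
    have g0: "0 \<le> g j" for j by (simp add: g_def)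
    have g2: "ennreal (2 * g j) = box_average (2 ^ j * h) (\<lambda>y. ennreal (a y)) x" for j
    proof -
      have R: "0 < 2 ^ j * h" using h by simp
      have "a y \<le> a y powr p y + 1" for y
        using a[of y] p1[of y] powr_mono[of 1 "p y" "a y"] by (cases "1 \<le> a y") (auto simp: add_increasing)
      then have "box_average (2 ^ j * h) (\<lambda>y. ennreal (a y)) x \<le>
          box_average (2 ^ j * h) (\<lambda>y. ennreal (a y powr p y) + 1) x"
        by (intro box_average_mono) (metis ennreal_1 ennreal_leI ennreal_plus powr_ge_zero zero_le_one)
      also have "\<dots> = box_average (2 ^ j * h) (\<lambda>y. ennreal (a y powr p y)) x + 1"
        using R by (simp add: box_average_add box_average_const_one)
      also have "\<dots> \<le> ennreal (1 / (2 * (2 ^ j * h))) * 1 + 1"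
        using R by (intro add_right_mono order_trans[OF box_average_le_nn_integral] mult_left_mono a1) auto
      also have "\<dots> < \<infinity>" by (simp add: ennreal_mult_less_top)
      finally show ?thesis by (simp add: g_def)
    qed
    have "ennreal 32 * ennreal (m x) = ennreal (32 * m x)" using m by (simp add: ennreal_mult)
    also have "\<dots> \<le> (\<integral>\<^sup>+ y. ennreal (cauchy_kernel h (y - x)) * ennreal (a y) \<partial>lborel)" by (rule m)
    also have "\<dots> \<le> ennreal 16 * (\<Sum>j. ennreal (dyadic_weight j) * box_average (2 ^ j * h) (\<lambda>y. ennreal (a y)) x)"
      by (rule cauchy_integral_le_averages[OF h]) measurable
    also have "\<dots> = ennreal 16 * (\<Sum>j. ennreal 2 * ennreal (dyadic_weight j * g j))"
    proof -
      have "ennreal (dyadic_weight j) * box_average (2 ^ j * h) (\<lambda>y. ennreal (a y)) x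
          = ennreal 2 * ennreal (dyadic_weight j * g j)" for j
        using g0[of j] unfolding g2[symmetric]
        by (subst (1 2) ennreal_mult[symmetric]) (auto simp: mult_ac)
      then show ?thesis by simp
    qed
    also have "\<dots> = ennreal 32 * (\<Sum>j. ennreal (dyadic_weight j * g j))"
      by (simp add: ennreal_suminf_cmult mult.assoc[symmetric] ennreal_mult[symmetric] del: ennreal_numeral)
    finally have "ennreal (m x) \<le> (\<Sum>j. ennreal (dyadic_weight j * g j))"
      by (subst (asm) ennreal_mult_le_mult_iff) auto
    then have "ennreal (m x powr p x) \<le> (\<integral>\<^sup>+ j. ennreal (dyadic_weight j * g j powr p x) \<partial>count_space UNIV)"
      using m p1 g0
      by (intro nn_integral_jensen_powr)
         (auto simp: nn_integral_count_space_nat suminf_dyadic_weight simp del: power_Suc)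
    also have "\<dots> = (\<Sum>j. ennreal (dyadic_weight j) * ennreal (g j powr p x))"
    proof -
      have "ennreal (dyadic_weight j * g j powr p x) = ennreal (dyadic_weight j) * ennreal (g j powr p x)" for j
        by (rule ennreal_mult) auto
      then show ?thesis by (simp only: nn_integral_count_space_nat)
    qed
    also have "\<dots> \<le> (\<Sum>j. ennreal (dyadic_weight j) * (K * (box_average (2 ^ j * h) F x + E x)))"
    proof (intro suminf_le mult_left_mono summableI)
      fix j
      show "ennreal (g j powr p x) \<le> K * (box_average (2 ^ j * h) F x + E x)"
        unfolding K_def F_def E_def
        by (rule box_average_bound[OF _ _ p1 c1 c a a1 _ g0]) (use h in \<open>auto simp: g2\<close>)
    qed auto
    finally show ?thesis .
  qed
  have "(\<integral>\<^sup>+ x. ennreal (m x powr p x) \<partial>lborel) \<le>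
      (\<integral>\<^sup>+ x. (\<Sum>j. ennreal (dyadic_weight j) * (K * (box_average (2 ^ j * h) F x + E x))) \<partial>lborel)"
    by (intro nn_integral_mono pw)
  also have "\<dots> = (\<Sum>j. ennreal (dyadic_weight j) * (K * ((\<integral>\<^sup>+ y. F y \<partial>lborel) + (\<integral>\<^sup>+ x. E x \<partial>lborel))))"
    using h by (simp add: nn_integral_suminf nn_integral_cmult nn_integral_add nn_integral_box_average)
  also have "\<dots> = K * ((\<integral>\<^sup>+ y. F y \<partial>lborel) + (\<integral>\<^sup>+ x. E x \<partial>lborel))"
    by (simp only: ennreal_suminf_multc suminf_dyadic_weight mult_1_left)
  also have "\<dots> \<le> K * ((1 + 16) + 16)"
    using E F by (intro mult_left_mono add_mono) auto
  also have "(1 + 16) + 16 = ennreal 33" by simp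
  finally show ?thesis by (simp add: K_def ennreal_mult mult.commute)
qed

section \<open>The Bernstein kernel\<close>

text \<open>With \<open>s = (sin (t / 2))\<^sup>2 \<le> t\<^sup>2 / 4\<close> the double angle formula reads \<open>(sin t)\<^sup>2 = 4 * s * (1 - s)\<close>, which
  increases in \<open>s\<close> up to \<open>1 / 2\<close>. For large \<open>t\<close> the bound \<open>(sin t)\<^sup>2 \<le> 1\<close> is enough.\<close>
lemma sin_sq_le: "(sin t)\<^sup>2 * (1 + t\<^sup>2 / 4) \<le> (t::real)\<^sup>2"
proof (cases "t\<^sup>2 \<le> 2")
  case True
  define s where "s = (sin (t / 2))\<^sup>2"
  have "\<bar>sin (t / 2)\<bar>\<^sup>2 \<le> \<bar>t / 2\<bar>\<^sup>2" by (intro power_mono abs_sin_x_le_abs_x) auto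
  then have s: "s \<le> t\<^sup>2 / 4" by (simp add: s_def power_divide)
  have "(sin t)\<^sup>2 = 4 * s * (1 - s)"
    using sin_double[of "t / 2"] by (simp add: s_def power_mult_distrib cos_squared_eq)
  also have "\<dots> \<le> t\<^sup>2 * (1 - t\<^sup>2 / 4)"
  proof -
    \<comment> \<open>The product is \<open>\<phi> (t\<^sup>2 / 4) - \<phi> s\<close> for \<open>\<phi> s = s * (1 - s)\<close>.\<close>
    have "0 \<le> (t\<^sup>2 / 4 - s) * (1 - s - t\<^sup>2 / 4)" using s True by (intro mult_nonneg_nonneg) auto
    then show ?thesis by (simp add: algebra_simps)
  qed
  finally have "(sin t)\<^sup>2 * (1 + t\<^sup>2 / 4) \<le> t\<^sup>2 * (1 - t\<^sup>2 / 4) * (1 + t\<^sup>2 / 4)"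
    by (intro mult_right_mono) auto
  also have "\<dots> = t\<^sup>2 - t\<^sup>2 * (t\<^sup>2 / 4)\<^sup>2" by (simp add: algebra_simps power2_eq_square)
  also have "\<dots> \<le> t\<^sup>2" by simp
  finally show ?thesis .
next
  case False
  have "(sin t)\<^sup>2 * (1 + t\<^sup>2 / 4) \<le> 1 * (1 + t\<^sup>2 / 4)"
    by (intro mult_right_mono) (auto simp: abs_square_le_1)
  also have "\<dots> \<le> t\<^sup>2" using False by simp
  finally show ?thesis .
qed

text \<open>This is the square of \<open>t * cos t \<le> sin t\<close>, with \<open>(cos t)\<^sup>2 = 1 - (sin t)\<^sup>2\<close>.\<close>
lemma sin_sq_ge:
  assumes "0 \<le> t" "t \<le> 1"
  shows "t\<^sup>2 \<le> (sin t)\<^sup>2 * (1 + (t::real)\<^sup>2)"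
proof -
  have "sin 0 - 0 * cos 0 \<le> sin t - t * cos t"
  proof (rule DERIV_nonneg_imp_nondecreasing[OF assms(1)])
    fix x assume x: "0 \<le> x" "x \<le> t"
    have "((\<lambda>x. sin x - x * cos x) has_real_derivative x * sin x) (at x)"
      by (auto intro!: derivative_eq_intros)
    moreover have "0 \<le> x * sin x" using x assms pi_gt3 by (intro mult_nonneg_nonneg sin_ge_zero) auto
    ultimately show "\<exists>y. ((\<lambda>x. sin x - x * cos x) has_real_derivative y) (at x) \<and> 0 \<le> y" by blast
  qed
  moreover have "0 \<le> cos t" using assms pi_gt3 by (intro cos_ge_zero) auto
  ultimately have "(t * cos t)\<^sup>2 \<le> (sin t)\<^sup>2" using assms by (intro power_mono) auto
  then show ?thesis by (simp add: power_mult_distrib cos_squared_eq algebra_simps)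
qed

text \<open>The width at which \<open>bern_g \<sigma> r\<close> is at most half its peak bound: it solves
  \<open>r * t\<^sup>2 / 4 = 1\<close> for \<open>t = \<sigma> * x / (2 * r)\<close>.\<close>
definition bern_scale :: "nat \<Rightarrow> real \<Rightarrow> real" where
  "bern_scale r \<sigma> = 4 * sqrt (real r) / \<sigma>"

lemma bern_g_alt: "bern_g \<sigma> r x = ((sin (\<sigma> / (2 * real r) * x))\<^sup>2 / x\<^sup>2) ^ r"
  by (simp add: bern_g_def power_mult power_divide)

lemma bern_g_nonneg: "0 \<le> bern_g \<sigma> r x"
  by (simp add: bern_g_alt)

lemma bern_g_measurable [measurable]: "bern_g \<sigma> r \<in> borel_measurable borel"
  unfolding bern_g_def by measurable

lemma bern_g_le:
  assumes "1 \<le> r" "0 < \<sigma>"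
  shows "bern_g \<sigma> r x \<le> (\<sigma> / (2 * real r)) ^ (2 * r) / (1 + (x / bern_scale r \<sigma>)\<^sup>2)"
proof (cases "x = 0")
  case True
  then show ?thesis using assms by (simp add: bern_g_def)
next
  case False
  define \<tau> where "\<tau> = \<sigma> / (2 * real r)"
  define t where "t = \<tau> * x"
  have pos: "0 < 1 + t\<^sup>2 / 4" by (intro add_pos_nonneg) auto
  have "(sin t)\<^sup>2 \<le> t\<^sup>2 / (1 + t\<^sup>2 / 4)" using sin_sq_le[of t] pos by (simp add: pos_le_divide_eq)
  then have "(sin t)\<^sup>2 / x\<^sup>2 \<le> t\<^sup>2 / (1 + t\<^sup>2 / 4) / x\<^sup>2" by (intro divide_right_mono) auto
  also have "\<dots> = \<tau>\<^sup>2 / (1 + t\<^sup>2 / 4)" using False by (simp add: t_def power_mult_distrib)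
  finally have "bern_g \<sigma> r x \<le> (\<tau>\<^sup>2 / (1 + t\<^sup>2 / 4)) ^ r"
    unfolding bern_g_alt \<tau>_def[symmetric] t_def[symmetric] by (intro power_mono) auto
  also have "\<dots> = \<tau> ^ (2 * r) / (1 + t\<^sup>2 / 4) ^ r" by (simp add: power_divide power_mult)
  also have "\<dots> \<le> \<tau> ^ (2 * r) / (1 + real r * (t\<^sup>2 / 4))"
  proof (intro divide_left_mono)
    show "1 + real r * (t\<^sup>2 / 4) \<le> (1 + t\<^sup>2 / 4) ^ r"
      by (rule Bernoulli_inequality) (rule order_trans[of _ 0], auto)
    have "0 < 1 + real r * (t\<^sup>2 / 4)" by (intro add_pos_nonneg) auto
    then show "0 < (1 + t\<^sup>2 / 4) ^ r * (1 + real r * (t\<^sup>2 / 4))" using pos by simp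
  qed simp
  also have "real r * (t\<^sup>2 / 4) = (x / bern_scale r \<sigma>)\<^sup>2"
  proof -
    have "(bern_scale r \<sigma>)\<^sup>2 = 16 * real r / \<sigma>\<^sup>2"
      by (simp add: bern_scale_def power_divide power_mult_distrib)
    moreover have "t\<^sup>2 = \<sigma>\<^sup>2 * x\<^sup>2 / (4 * (real r * real r))"
      by (simp add: t_def \<tau>_def power_divide power_mult_distrib) (simp add: power2_eq_square)
    ultimately show ?thesis using assms by (simp add: power_divide)
  qed
  finally show ?thesis by (simp add: \<tau>_def)
qed

lemma bern_g_ge:
  assumes r: "1 \<le> r" and \<sigma>: "0 < \<sigma>" and x: "0 < x" "x \<le> bern_scale r \<sigma> / 2"
  shows "(\<sigma> / (2 * real r)) ^ (2 * r) / exp 1 \<le> bern_g \<sigma> r x"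
proof -
  define \<tau> where "\<tau> = \<sigma> / (2 * real r)"
  define t where "t = \<tau> * x"
  have "0 < \<tau>" using assms by (simp add: \<tau>_def)
  then have t0: "0 < t" using x by (simp add: t_def)
  have "t \<le> \<tau> * (bern_scale r \<sigma> / 2)"
    unfolding t_def using x \<open>0 < \<tau>\<close> by (intro mult_left_mono) auto
  also have "\<dots> = sqrt (real r) / real r" using assms by (simp add: \<tau>_def bern_scale_def)
  also have "\<dots> = 1 / sqrt (real r)" using r by (simp add: field_simps)
  finally have t: "t \<le> 1 / sqrt (real r)" .
  moreover have "1 / sqrt (real r) \<le> 1" using r by simp
  ultimately have t1: "t \<le> 1" by linarith
  have "t\<^sup>2 \<le> (1 / sqrt (real r))\<^sup>2" using t t0 by (intro power_mono) auto
  then have rt: "real r * t\<^sup>2 \<le> 1" using r by (simp add: power_divide field_simps)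
  have pos: "0 < 1 + t\<^sup>2" by (intro add_pos_nonneg) auto
  have "(1 + t\<^sup>2) ^ r \<le> exp (t\<^sup>2) ^ r" by (intro power_mono) (auto simp: exp_ge_add_one_self)
  also have "\<dots> = exp (real r * t\<^sup>2)" by (simp add: exp_of_nat_mult)
  also have "\<dots> \<le> exp 1" using rt by simp
  finally have "(1 + t\<^sup>2) ^ r \<le> exp 1" .
  then have "\<tau> ^ (2 * r) / exp 1 \<le> \<tau> ^ (2 * r) / (1 + t\<^sup>2) ^ r"
    using pos by (intro divide_left_mono) (auto simp: power_mult)
  also have "\<dots> = (\<tau>\<^sup>2 / (1 + t\<^sup>2)) ^ r" by (simp add: power_divide power_mult)
  also have "\<dots> \<le> ((sin t)\<^sup>2 / x\<^sup>2) ^ r"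
  proof (intro power_mono)
    have "\<tau>\<^sup>2 / (1 + t\<^sup>2) = t\<^sup>2 / (1 + t\<^sup>2) / x\<^sup>2" using x by (simp add: t_def power_mult_distrib)
    also have "\<dots> \<le> (sin t)\<^sup>2 / x\<^sup>2"
      using sin_sq_ge[of t] t0 t1 pos by (intro divide_right_mono) (auto simp: pos_divide_le_eq)
    finally show "\<tau>\<^sup>2 / (1 + t\<^sup>2) \<le> (sin t)\<^sup>2 / x\<^sup>2" .
  qed (use pos in auto)
  finally show ?thesis by (simp add: bern_g_alt \<tau>_def t_def)
qed

text \<open>Up to \<open>bern_scale r \<sigma> / 2\<close> the integrand stays within the factor \<open>exp 1\<close> of its peak bound.\<close>
lemma bern_gamma_ge:
  assumes r: "1 \<le> r" and \<sigma>: "0 < \<sigma>"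
  shows "(\<sigma> / (2 * real r)) ^ (2 * r) * bern_scale r \<sigma> / (2 * exp 1) \<le> bern_gamma r \<sigma>"
proof -
  define h where "h = bern_scale r \<sigma>"
  define S where "S = (\<sigma> / (2 * real r)) ^ (2 * r)"
  have h: "0 < h" using assms by (simp add: h_def bern_scale_def)
  have S: "0 \<le> S" by (simp add: S_def power_mult)
  have int: "integrable lborel (bern_g \<sigma> r)"
  proof (rule Bochner_Integration.integrable_bound)
    show "integrable lborel (\<lambda>z. S * h * cauchy_kernel h z)"
      using integrable_cauchy_kernel[OF h] by simp
    show "AE x in lborel. norm (bern_g \<sigma> r x) \<le> norm (S * h * cauchy_kernel h x)"
      using bern_g_le[OF assms] h S bern_g_nonneg
      by (auto simp: cauchy_kernel_def abs_mult S_def h_def)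
  qed measurable
  have "S * h / (2 * exp 1) = (LINT x|lborel. indicator {0<..h / 2} x * (S / exp 1))"
    using h by simp
  also have "\<dots> \<le> (LINT x|lborel. bern_g \<sigma> r x)"
  proof (rule integral_mono)
    show "indicator {0<..h / 2} x * (S / exp 1) \<le> bern_g \<sigma> r x" for x
      using bern_g_ge[OF assms, of x] bern_g_nonneg[of \<sigma> r x]
      by (auto simp: indicator_def S_def h_def)
    show "integrable lborel (\<lambda>x. indicator {0<..h / 2} x * (S / exp 1))"
      using h by (intro integrable_mult_left) (simp add: integrable_indicator_iff)
  qed (rule int)
  also have "\<dots> = bern_gamma r \<sigma>"
    unfolding bern_gamma_def bern_g_def[symmetric] by (simp add: integral_completion)
  finally show ?thesis by (simp add: S_def h_def)
qed

lemma bern_G_measurable [measurable]: "bern_G \<sigma> r k \<in> borel_measurable borel"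
  unfolding bern_G_def by measurable

text \<open>Stretching the Cauchy profile by \<open>v \<ge> 1\<close> costs at most the factor \<open>v\<^sup>2\<close>, so all summands of \<open>bern_G\<close>
  are controlled at the same scale. The peak bound \<open>(\<sigma> / (2 * r)) ^ (2 * r)\<close> of \<open>bern_g\<close>
  cancels against the same factor in the lower bound of \<open>bern_gamma\<close>.\<close>
lemma bern_kernel_le:
  assumes r: "1 \<le> r" and \<sigma>: "0 < \<sigma>"
  shows "\<bar>bern_G \<sigma> r k z\<bar> / bern_gamma r \<sigma> \<le>
    2 * exp 1 * (\<Sum>v=1..k. real v * real (k choose v)) * cauchy_kernel (bern_scale r \<sigma>) z"
proof -
  define h where "h = bern_scale r \<sigma>"
  define S where "S = (\<sigma> / (2 * real r)) ^ (2 * r)"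
  define N where "N = (\<Sum>v=1..k. real v * real (k choose v))"
  have h: "0 < h" using assms by (simp add: h_def bern_scale_def)
  have S: "0 < S" using assms by (simp add: S_def)
  have "\<bar>bern_G \<sigma> r k z\<bar> \<le> (\<Sum>v=1..k. \<bar>(-1) ^ (k - v) * (1 / real v) * real (k choose v) * bern_g \<sigma> r (z / real v)\<bar>)"
    unfolding bern_G_def by (rule sum_abs)
  also have "\<dots> \<le> (\<Sum>v=1..k. real v * real (k choose v) * (S / (1 + (z / h)\<^sup>2)))"
  proof (intro sum_mono)
    fix v assume "v \<in> {1..k}"
    then have v: "1 \<le> real v" by simp
    have pos: "0 < 1 + (z / h)\<^sup>2" "0 < 1 + (z / real v / h)\<^sup>2" by (auto intro!: add_pos_nonneg)
    have "1 + (z / h)\<^sup>2 \<le> (real v)\<^sup>2 + (z / h)\<^sup>2" using v by (simp add: one_le_power)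
    also have "\<dots> = (real v)\<^sup>2 * (1 + (z / real v / h)\<^sup>2)" using v h by (simp add: field_simps)
    finally have le: "1 + (z / h)\<^sup>2 \<le> (real v)\<^sup>2 * (1 + (z / real v / h)\<^sup>2)" .
    have "bern_g \<sigma> r (z / real v) \<le> S / (1 + (z / real v / h)\<^sup>2)"
      unfolding S_def h_def by (rule bern_g_le[OF assms])
    also have "\<dots> \<le> (real v)\<^sup>2 * (S / (1 + (z / h)\<^sup>2))"
      using mult_left_mono[OF le, of S] S pos by (simp add: pos_divide_le_eq pos_le_divide_eq mult_ac)
    finally have "1 / real v * real (k choose v) * bern_g \<sigma> r (z / real v) \<le>
        1 / real v * real (k choose v) * ((real v)\<^sup>2 * (S / (1 + (z / h)\<^sup>2)))"
      by (intro mult_left_mono) auto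
    also have "\<dots> = real v * real (k choose v) * (S / (1 + (z / h)\<^sup>2))"
      using v by (simp add: power2_eq_square)
    finally show "\<bar>(-1) ^ (k - v) * (1 / real v) * real (k choose v) * bern_g \<sigma> r (z / real v)\<bar> \<le>
        real v * real (k choose v) * (S / (1 + (z / h)\<^sup>2))"
      by (simp add: abs_mult power_abs bern_g_nonneg)
  qed
  also have "\<dots> = N * (S / (1 + (z / h)\<^sup>2))"
    by (simp only: N_def sum_distrib_right)
  also have "\<dots> = N * S * h * cauchy_kernel h z"
    using h by (simp add: cauchy_kernel_def)
  finally have G: "\<bar>bern_G \<sigma> r k z\<bar> \<le> N * S * h * cauchy_kernel h z" .
  have gam: "S * h / (2 * exp 1) \<le> bern_gamma r \<sigma>"
    unfolding S_def h_def by (rule bern_gamma_ge[OF assms])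
  have "0 < S * h / (2 * exp 1)" using S h by simp
  then have "\<bar>bern_G \<sigma> r k z\<bar> / bern_gamma r \<sigma> \<le> N * S * h * cauchy_kernel h z / (S * h / (2 * exp 1))"
    using G gam by (intro frac_le) auto
  also have "\<dots> = 2 * exp 1 * N * cauchy_kernel h z" using S h by simp
  finally show ?thesis by (simp add: N_def h_def)
qed

section \<open>From modulars to Luxemburg norms\<close>

lemma modular_divide_le:
  assumes [measurable]: "p \<in> borel_measurable lebesgue" "f \<in> borel_measurable lebesgue"
    and p1: "\<And>x. 1 \<le> p x" and l: "1 \<le> l"
  shows "modular p (\<lambda>y. f y / of_real l) \<le> ennreal (1 / l) * modular p f"
proof -
  have "modular p (\<lambda>y. f y / of_real l) \<le> (\<integral>\<^sup>+ y. ennreal (1 / l) * ennreal (cmod (f y) powr p y) \<partial>lebesgue)"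
    unfolding modular_def
  proof (intro nn_integral_mono)
    fix y
    have "l \<le> l powr p y" using powr_mono[of 1 "p y" l] p1[of y] l by simp
    then have "cmod (f y) powr p y / l powr p y \<le> cmod (f y) powr p y / l"
      using l by (intro divide_left_mono) auto
    then have "cmod (f y / of_real l) powr p y \<le> 1 / l * cmod (f y) powr p y"
      using l by (simp add: norm_divide powr_divide)
    then have "ennreal (cmod (f y / of_real l) powr p y) \<le> ennreal (1 / l * cmod (f y) powr p y)"
      by (rule ennreal_leI)
    also have "\<dots> = ennreal (1 / l) * ennreal (cmod (f y) powr p y)"
      using l by (intro ennreal_mult) auto
    finally show "ennreal (cmod (f y / of_real l) powr p y) \<le> ennreal (1 / l) * ennreal (cmod (f y) powr p y)" .
  qed
  also have "\<dots> = ennreal (1 / l) * modular p f"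
    unfolding modular_def by (rule nn_integral_cmult) measurable
  finally show ?thesis .
qed

lemma modular_divide_less_one:
  assumes meas: "p \<in> borel_measurable lebesgue" "f \<in> borel_measurable lebesgue"
    and p1: "\<And>x. 1 \<le> p x" and B: "0 \<le> B" "modular p f \<le> ennreal B"
  shows "modular p (\<lambda>y. f y / of_real (B + 1)) < 1"
proof -
  have "modular p (\<lambda>y. f y / of_real (B + 1)) \<le> ennreal (1 / (B + 1)) * modular p f"
    using meas p1 B by (intro modular_divide_le) auto
  also have "\<dots> \<le> ennreal (1 / (B + 1)) * ennreal B" by (intro mult_left_mono B) auto
  also have "\<dots> = ennreal (1 / (B + 1) * B)" using B by (intro ennreal_mult[symmetric]) auto
  also have "\<dots> < ennreal 1" using B by (subst ennreal_less_iff) auto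
  finally show ?thesis by simp
qed

lemma Lvar_modular_less_one:
  assumes p: "p \<in> borel_measurable lebesgue" "\<And>x. 1 \<le> p x" and f: "f \<in> Lvar p"
  obtains \<eta> where "0 < \<eta>" "modular p (\<lambda>y. f y / of_real \<eta>) < 1"
proof -
  from f obtain c where c: "0 < c" "modular p (\<lambda>y. f y / of_real c) < \<infinity>"
    and [measurable]: "f \<in> borel_measurable lebesgue"
    by (auto simp: Lvar_def)
  define B where "B = enn2real (modular p (\<lambda>y. f y / of_real c))"
  have B: "0 \<le> B" "modular p (\<lambda>y. f y / of_real c) \<le> ennreal B"
    using c by (auto simp: B_def)
  have "modular p (\<lambda>y. f y / of_real c / of_real (B + 1)) < 1"
    by (rule modular_divide_less_one[OF p(1) _ p(2) B]) measurable
  then have "modular p (\<lambda>y. f y / of_real (c * (B + 1))) < 1" by simp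
  moreover have "0 < c * (B + 1)" using c B by simp
  ultimately show ?thesis using that by blast
qed

text \<open>Scaling by \<open>C\<close> maps the set whose infimum is the norm of \<open>f\<close> into the corresponding set for \<open>g\<close>.\<close>
lemma Lvar_bounded_operator:
  assumes C: "0 < C" and g: "g \<in> borel_measurable lebesgue"
    and p: "p \<in> borel_measurable lebesgue" "\<And>x. 1 \<le> p x" and f: "f \<in> Lvar p"
    and step: "\<And>\<eta>. 0 < \<eta> \<Longrightarrow> modular p (\<lambda>y. f y / of_real \<eta>) < 1 \<Longrightarrow>
      modular p (\<lambda>y. g y / of_real (C * \<eta>)) < 1"
  shows "g \<in> Lvar p \<and> Lvar_norm p g \<le> C * Lvar_norm p f"
proof
  define S where "S = {\<eta>::real. 0 < \<eta> \<and> modular p (\<lambda>y. f y / of_real \<eta>) < 1}"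
  obtain \<eta>0 where \<eta>0: "\<eta>0 \<in> S"
    using Lvar_modular_less_one[OF p f] by (auto simp: S_def)
  then have "modular p (\<lambda>y. g y / of_real (C * \<eta>0)) < 1" "0 < C * \<eta>0"
    using step[of \<eta>0] C by (auto simp: S_def)
  then show "g \<in> Lvar p"
    using g by (auto simp: Lvar_def intro!: exI[of _ "C * \<eta>0"] intro: less_trans[where y = 1])
  have "Lvar_norm p g / C \<le> \<eta>" if "\<eta> \<in> S" for \<eta>
  proof -
    have "Lvar_norm p g \<le> C * \<eta>"
      unfolding Lvar_norm_def using that step[of \<eta>] C
      by (intro cInf_lower) (auto simp: S_def intro!: bdd_belowI[of _ 0])
    then show ?thesis using C by (simp add: field_simps)
  qed
  then have "Lvar_norm p g / C \<le> Inf S" using \<eta>0 by (intro cInf_greatest) auto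
  then show "Lvar_norm p g \<le> C * Lvar_norm p f"
    using C unfolding Lvar_norm_def[of p f] S_def[symmetric] by (simp add: field_simps)
qed

section \<open>Measurability and the size of Bernstein integrals\<close>

text \<open>Tonelli's theorem is applied to Lebesgue measure on Borel sets; passing to a Borel function
  changes neither the modular nor the Bernstein integral.\<close>
lemma borel_representative:
  fixes f :: "real \<Rightarrow> complex"
  assumes "f \<in> borel_measurable lebesgue"
  obtains f' where "f' \<in> borel_measurable borel" "AE x in lebesgue. f x = f' x"
proof -
  have "(\<lambda>x. Re (f x)) \<in> borel_measurable lebesgue" "(\<lambda>x. Im (f x)) \<in> borel_measurable lebesgue"
    using assms by measurable
  then obtain u v where [measurable]: "u \<in> borel_measurable lborel" "v \<in> borel_measurable lborel"
    and uv: "AE x in lborel. Re (f x) = u x" "AE x in lborel. Im (f x) = v x"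
    using completion_ex_borel_measurable_real by metis
  show ?thesis
  proof
    show "(\<lambda>x. Complex (u x) (v x)) \<in> borel_measurable borel"
      unfolding Complex_eq by measurable
    have "AE x in lborel. f x = Complex (u x) (v x)"
      using uv by eventually_elim (simp add: complex_eq_iff)
    then show "AE x in lebesgue. f x = Complex (u x) (v x)" by (rule AE_completion)
  qed
qed

text \<open>Continuity makes \<open>p\<close> Borel measurable: \<open>\<bar>x - y\<bar> < exp (- c1 / e)\<close> makes the logarithm exceed \<open>c1 / e\<close>.\<close>
lemma log_exponents_continuous:
  assumes c1: "0 < c1" "\<And>x y. \<bar>p x - p y\<bar> * ln (exp 1 + 1 / \<bar>x - y\<bar>) \<le> c1"
  shows "continuous_on UNIV (p :: real \<Rightarrow> real)"
  unfolding continuous_on_iff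
proof (intro ballI allI impI)
  fix x e :: real assume e: "0 < e"
  define \<delta> where "\<delta> = exp (- (c1 / e))"
  have "dist (p y) (p x) < e" if "dist y x < \<delta>" for y
  proof (cases "y = x")
    case False
    have "1 / \<delta> \<le> 1 / \<bar>y - x\<bar>" using that False
      by (intro divide_left_mono) (auto simp: dist_real_def \<delta>_def)
    then have "exp (c1 / e) \<le> 1 / \<bar>y - x\<bar>" by (simp add: \<delta>_def exp_minus inverse_eq_divide)
    then have "exp (c1 / e) < exp 1 + 1 / \<bar>y - x\<bar>"
      using exp_gt_zero[of "1 :: real"] by linarith
    then have "ln (exp (c1 / e)) < ln (exp 1 + 1 / \<bar>y - x\<bar>)"
      by (subst ln_less_cancel_iff) (auto intro!: add_pos_nonneg)
    then have *: "c1 / e < ln (exp 1 + 1 / \<bar>y - x\<bar>)" by simp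
    show ?thesis
    proof (rule ccontr)
      assume "\<not> ?thesis"
      then have "e \<le> \<bar>p y - p x\<bar>" by (simp add: dist_real_def)
      then have "e * (c1 / e) < \<bar>p y - p x\<bar> * ln (exp 1 + 1 / \<bar>y - x\<bar>)"
        using * e c1(1) by (intro mult_le_less_imp_less) auto
      then show False using c1(2)[of y x] e by simp
    qed
  qed (use e in simp)
  moreover have "0 < \<delta>" by (simp add: \<delta>_def)
  ultimately show "\<exists>d>0. \<forall>y\<in>UNIV. dist y x < d \<longrightarrow> dist (p y) (p x) < e" by blast
qed

text \<open>Outside the integrable case the Bochner integral is 0 by convention.\<close>
lemma cmod_integral_le:
  fixes F :: "real \<Rightarrow> complex"
  shows "ennreal (cmod (LINT u|M. F u)) \<le> (\<integral>\<^sup>+ u. ennreal (cmod (F u)) \<partial>M)"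
  by (cases "integrable M F") (auto simp: integral_norm_bound_ennreal not_integrable_integral_eq)

text \<open>A normalised \<open>f\<close> satisfies \<open>\<bar>f\<bar> \<le> 1 + \<bar>f\<bar> powr p\<close>, and the weight \<open>1 / (1 + u ^ (2 * r))\<close> is both bounded by 1
  and integrable.\<close>
lemma Lvar_bernstein_domain:
  assumes p: "p \<in> borel_measurable lebesgue" "\<And>x. 1 \<le> p x" and f: "f \<in> Lvar p" and r: "1 \<le> r"
  shows "f \<in> bernstein_domain r"
proof -
  have [measurable]: "f \<in> borel_measurable lebesgue" "p \<in> borel_measurable lebesgue"
    using f p by (auto simp: Lvar_def)
  obtain \<eta> where \<eta>: "0 < \<eta>" "modular p (\<lambda>y. f y / of_real \<eta>) < 1"
    by (rule Lvar_modular_less_one[OF p f])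
  define b where "b = (\<lambda>u. cmod (f u / of_real \<eta>))"
  have [measurable]: "b \<in> borel_measurable lebesgue" unfolding b_def by measurable
  have "(\<integral>\<^sup>+ u. ennreal (cmod (f u) / (1 + u ^ (2 * r))) \<partial>lebesgue) \<le>
      (\<integral>\<^sup>+ u. ennreal \<eta> * (ennreal (b u powr p u) + ennreal 2 * ennreal (1 / (1 + u\<^sup>2))) \<partial>lebesgue)"
  proof (intro nn_integral_mono)
    fix u :: real
    have pos: "0 < 1 + u\<^sup>2" "1 \<le> 1 + u ^ (2 * r)" "0 < 1 + u ^ (2 * r)"
      by (auto intro!: add_pos_nonneg simp: power_mult)
    have "1 + u\<^sup>2 \<le> 2 * (1 + u ^ (2 * r))"
    proof (cases "u\<^sup>2 \<le> 1")
      case True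
      then have "1 + u\<^sup>2 \<le> 2 * 1" by simp
      also have "\<dots> \<le> 2 * (1 + u ^ (2 * r))" using pos(2) by (intro mult_left_mono) auto
      finally show ?thesis .
    next
      case False
      then have "(u\<^sup>2) ^ 1 \<le> (u\<^sup>2) ^ r" using r by (intro power_increasing) auto
      then show ?thesis using pos by (simp add: power_mult)
    qed
    then have w: "1 / (1 + u ^ (2 * r)) \<le> 2 * (1 / (1 + u\<^sup>2))"
      using pos by (simp add: divide_simps)
    have b0: "0 \<le> b u" by (simp add: b_def)
    have "b u / (1 + u ^ (2 * r)) \<le> b u powr p u + 2 * (1 / (1 + u\<^sup>2))"
    proof (cases "1 \<le> b u")
      case True
      have "b u / (1 + u ^ (2 * r)) \<le> b u / 1" using pos b0 by (intro divide_left_mono) auto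
      also have "\<dots> \<le> b u powr p u" using True p(2)[of u] powr_mono[of 1 "p u" "b u"] by simp
      finally show ?thesis using pos by (simp add: add_increasing2)
    next
      case False
      then have "b u / (1 + u ^ (2 * r)) \<le> 1 / (1 + u ^ (2 * r))"
        using pos by (intro divide_right_mono) auto
      then show ?thesis using w by (simp add: add_increasing)
    qed
    then have "\<eta> * (b u / (1 + u ^ (2 * r))) \<le> \<eta> * (b u powr p u + 2 * (1 / (1 + u\<^sup>2)))"
      using \<eta> by (intro mult_left_mono) auto
    moreover have "cmod (f u) / (1 + u ^ (2 * r)) = \<eta> * (b u / (1 + u ^ (2 * r)))"
      using \<eta> by (simp add: b_def norm_divide)
    ultimately have "ennreal (cmod (f u) / (1 + u ^ (2 * r))) \<le>
        ennreal (\<eta> * (b u powr p u + 2 * (1 / (1 + u\<^sup>2))))"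
      by (simp only: ennreal_leI)
    also have "\<dots> = ennreal \<eta> * (ennreal (b u powr p u) + ennreal 2 * ennreal (1 / (1 + u\<^sup>2)))"
    proof -
      have nn: "0 \<le> 1 / (1 + u\<^sup>2)" "0 \<le> \<eta>" using pos \<eta> by auto
      have two: "ennreal (2 * (1 / (1 + u\<^sup>2))) = ennreal 2 * ennreal (1 / (1 + u\<^sup>2))"
        by (rule ennreal_mult) (use nn in auto)
      have plus: "ennreal (b u powr p u + 2 * (1 / (1 + u\<^sup>2))) =
          ennreal (b u powr p u) + ennreal (2 * (1 / (1 + u\<^sup>2)))"
        by (rule ennreal_plus) (use nn in auto)
      have "ennreal (\<eta> * (b u powr p u + 2 * (1 / (1 + u\<^sup>2)))) =
          ennreal \<eta> * ennreal (b u powr p u + 2 * (1 / (1 + u\<^sup>2)))"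
        by (rule ennreal_mult) (use nn in auto)
      then show ?thesis by (simp only: plus two)
    qed
    finally show "ennreal (cmod (f u) / (1 + u ^ (2 * r))) \<le>
        ennreal \<eta> * (ennreal (b u powr p u) + ennreal 2 * ennreal (1 / (1 + u\<^sup>2)))" .
  qed
  also have "\<dots> = ennreal \<eta> * (modular p (\<lambda>y. f y / of_real \<eta>) +
      ennreal 2 * (\<integral>\<^sup>+ u. ennreal (1 / (1 + u\<^sup>2)) \<partial>lebesgue))"
  proof -
    have [measurable]: "(\<lambda>u::real. ennreal (1 / (1 + u\<^sup>2))) \<in> borel_measurable lebesgue"
      by (intro measurable_completion) measurable
    have "(\<integral>\<^sup>+ u. ennreal \<eta> * (ennreal (b u powr p u) + ennreal 2 * ennreal (1 / (1 + u\<^sup>2))) \<partial>lebesgue) =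
        ennreal \<eta> * (\<integral>\<^sup>+ u. ennreal (b u powr p u) + ennreal 2 * ennreal (1 / (1 + u\<^sup>2)) \<partial>lebesgue)"
      by (rule nn_integral_cmult) measurable
    also have "(\<integral>\<^sup>+ u. ennreal (b u powr p u) + ennreal 2 * ennreal (1 / (1 + u\<^sup>2)) \<partial>lebesgue) =
        (\<integral>\<^sup>+ u. ennreal (b u powr p u) \<partial>lebesgue) +
        (\<integral>\<^sup>+ u. ennreal 2 * ennreal (1 / (1 + u\<^sup>2)) \<partial>lebesgue)"
      by (rule nn_integral_add) measurable
    also have "(\<integral>\<^sup>+ u. ennreal 2 * ennreal (1 / (1 + u\<^sup>2)) \<partial>lebesgue) =
        ennreal 2 * (\<integral>\<^sup>+ u. ennreal (1 / (1 + u\<^sup>2)) \<partial>lebesgue)"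
      by (rule nn_integral_cmult) measurable
    finally show ?thesis by (simp only: modular_def b_def)
  qed
  also have "\<dots> \<le> ennreal \<eta> * (1 + ennreal 2 * 16)"
    using \<eta> nn_integral_inverse_one_plus_sq_le
    by (intro mult_left_mono add_mono) (auto simp: nn_integral_completion)
  also have "\<dots> < \<infinity>" by (simp add: ennreal_mult_less_top)
  finally show ?thesis by (simp add: bernstein_domain_def)
qed

lemma bernstein_cong_AE:
  assumes "AE x in lebesgue. f x = f' x"
    and [measurable]: "f \<in> borel_measurable lebesgue" "f' \<in> borel_measurable lebesgue"
  shows "bernstein r \<sigma> k f = bernstein r \<sigma> k f'"
proof
  fix x
  have [measurable]: "(\<lambda>u. bern_G \<sigma> r k (u - x)) \<in> borel_measurable lebesgue"
    by (intro measurable_completion) measurable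
  have "(LINT u|lebesgue. f u * of_real (bern_G \<sigma> r k (u - x))) =
      (LINT u|lebesgue. f' u * of_real (bern_G \<sigma> r k (u - x)))"
    using assms(1) by (intro integral_cong_AE) auto
  then show "bernstein r \<sigma> k f x = bernstein r \<sigma> k f' x" by (simp add: bernstein_def)
qed

lemma modular_cong_AE:
  assumes "AE x in lebesgue. f x = f' x"
  shows "modular p f = modular p f'"
  unfolding modular_def using assms by (intro nn_integral_cong_AE) auto

lemma bernstein_borel:
  assumes [measurable]: "f \<in> borel_measurable borel"
  shows "bernstein r \<sigma> k f x = of_real ((-1) ^ (k + 1) / bern_gamma r \<sigma>) *
       (LINT u|lborel. f u * of_real (bern_G \<sigma> r k (u - x)))"
  unfolding bernstein_def by (subst integral_completion) auto

lemma bernstein_measurable: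
  assumes [measurable]: "f \<in> borel_measurable borel"
  shows "bernstein r \<sigma> k f \<in> borel_measurable borel"
proof -
  have "(\<lambda>x. of_real ((-1) ^ (k + 1) / bern_gamma r \<sigma>) *
       (LINT u|lborel. f u * of_real (bern_G \<sigma> r k (u - x)))) \<in> borel_measurable borel"
    by measurable
  then show ?thesis by (subst bernstein_borel[OF assms, abs_def])
qed

lemma bernstein_le_cauchy:
  assumes [measurable]: "f \<in> borel_measurable borel" and r: "1 \<le> r" and \<sigma>: "0 < \<sigma>"
  shows "ennreal (cmod (bernstein r \<sigma> k f x)) \<le>
    ennreal (2 * exp 1 * (\<Sum>v=1..k. real v * real (k choose v))) *
    (\<integral>\<^sup>+ u. ennreal (cauchy_kernel (bern_scale r \<sigma>) (u - x)) * ennreal (cmod (f u)) \<partial>lborel)"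
proof -
  define N where "N = 2 * exp 1 * (\<Sum>v=1..k. real v * real (k choose v))"
  define \<gamma> where "\<gamma> = bern_gamma r \<sigma>"
  have N: "0 \<le> N" unfolding N_def by (intro mult_nonneg_nonneg sum_nonneg) auto
  have h: "0 < bern_scale r \<sigma>" using r \<sigma> by (simp add: bern_scale_def)
  then have "0 < (\<sigma> / (2 * real r)) ^ (2 * r) * bern_scale r \<sigma> / (2 * exp 1)" using r \<sigma> by simp
  also have "\<dots> \<le> \<gamma>" unfolding \<gamma>_def by (rule bern_gamma_ge[OF r \<sigma>])
  finally have \<gamma>: "0 < \<gamma>" .
  have "bernstein r \<sigma> k f x =
      (LINT u|lborel. of_real ((-1) ^ (k + 1) / \<gamma>) * (f u * of_real (bern_G \<sigma> r k (u - x))))"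
    by (simp only: bernstein_borel[OF assms(1)] \<gamma>_def integral_mult_right_zero)
  then have "ennreal (cmod (bernstein r \<sigma> k f x)) \<le>
      (\<integral>\<^sup>+ u. ennreal (cmod (of_real ((-1) ^ (k + 1) / \<gamma>) * (f u * of_real (bern_G \<sigma> r k (u - x))))) \<partial>lborel)"
    by (simp only: cmod_integral_le)
  also have "\<dots> \<le> (\<integral>\<^sup>+ u. ennreal N * (ennreal (cauchy_kernel (bern_scale r \<sigma>) (u - x)) * ennreal (cmod (f u))) \<partial>lborel)"
  proof (intro nn_integral_mono)
    fix u
    have "cmod (of_real ((-1) ^ (k + 1) / \<gamma>) * (f u * of_real (bern_G \<sigma> r k (u - x)))) =
        \<bar>bern_G \<sigma> r k (u - x)\<bar> / \<gamma> * cmod (f u)"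
      using \<gamma> by (simp add: norm_mult norm_divide norm_power)
    also have "\<dots> \<le> N * cauchy_kernel (bern_scale r \<sigma>) (u - x) * cmod (f u)"
      unfolding N_def \<gamma>_def by (intro mult_right_mono bern_kernel_le[OF r \<sigma>]) auto
    also have "\<dots> = N * (cauchy_kernel (bern_scale r \<sigma>) (u - x) * cmod (f u))" by simp
    finally have "ennreal (cmod (of_real ((-1) ^ (k + 1) / \<gamma>) * (f u * of_real (bern_G \<sigma> r k (u - x))))) \<le>
        ennreal (N * (cauchy_kernel (bern_scale r \<sigma>) (u - x) * cmod (f u)))" by (rule ennreal_leI)
    also have "\<dots> = ennreal N * (ennreal (cauchy_kernel (bern_scale r \<sigma>) (u - x)) * ennreal (cmod (f u)))"
      using N h by (simp only: ennreal_mult cauchy_kernel_nonneg norm_ge_zero mult_nonneg_nonneg)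
    finally show "ennreal (cmod (of_real ((-1) ^ (k + 1) / \<gamma>) * (f u * of_real (bern_G \<sigma> r k (u - x))))) \<le>
        ennreal N * (ennreal (cauchy_kernel (bern_scale r \<sigma>) (u - x)) * ennreal (cmod (f u)))" .
  qed
  also have "\<dots> = ennreal N *
      (\<integral>\<^sup>+ u. ennreal (cauchy_kernel (bern_scale r \<sigma>) (u - x)) * ennreal (cmod (f u)) \<partial>lborel)"
    by (rule nn_integral_cmult) measurable
  finally show ?thesis by (simp only: N_def)
qed

section \<open>Uniform boundedness of the Bernstein integrals\<close>

theorem theorem5p9:
  fixes p :: "real \<Rightarrow> real" and k :: nat
  assumes "p \<in> log_exponents" and "k \<ge> 1"
  shows "\<exists>C::real. C > 0 \<and> (\<forall>(r::nat) (\<sigma>::real) (f :: real \<Rightarrow> complex).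
           r \<ge> 1 \<longrightarrow> real r \<ge> 1 / 2 * (real k + 2) \<longrightarrow> \<sigma> > 0 \<longrightarrow> f \<in> Lvar p \<longrightarrow>
             f \<in> bernstein_domain r \<and>
             bernstein r \<sigma> k f \<in> Lvar p \<and>
             Lvar_norm p (bernstein r \<sigma> k f) \<le> C * Lvar_norm p f)"
proof -
  from assms(1) have p1: "1 \<le> p x" and p_leb: "p \<in> borel_measurable lebesgue" for x
    by (auto simp: log_exponents_def exponents_def)
  from assms(1) obtain c1 c2 c3 where c1: "0 < c1" "\<And>x y. \<bar>p x - p y\<bar> * ln (exp 1 + 1 / \<bar>x - y\<bar>) \<le> c1"
    and c2: "0 < c2" "\<And>x. \<bar>p x - c3\<bar> * ln (exp 1 + \<bar>x\<bar>) \<le> c2"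
    unfolding log_exponents_def by blast
  \<comment> \<open>Replacing \<open>c3\<close> by \<open>max 1 c3\<close> only shrinks the distance to \<open>p x \<ge> 1\<close>.\<close>
  define s where "s = max 1 c3"
  have s: "\<bar>p x - s\<bar> * ln (exp 1 + \<bar>x\<bar>) \<le> c2" for x
  proof -
    have "\<bar>p x - s\<bar> * ln (exp 1 + \<bar>x\<bar>) \<le> \<bar>p x - c3\<bar> * ln (exp 1 + \<bar>x\<bar>)"
      using p1[of x] by (intro mult_right_mono ln_ge_zero) (auto simp: s_def intro: add_increasing2)
    then show ?thesis using c2(2)[of x] by linarith
  qed
  have [measurable]: "p \<in> borel_measurable borel"
    by (rule borel_measurable_continuous_onI[OF log_exponents_continuous[OF c1]])
  define N where "N = 2 * exp 1 * (\<Sum>v=1..k. real v * real (k choose v))"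
  define B where "B = 33 * exp (c1 + 4 * c2)"
  have "0 < (\<Sum>v=1..k. real v * real (k choose v))"
    using assms(2) by (intro sum_pos) auto
  then have N: "0 < N" by (simp add: N_def)
  have B: "0 < B" by (simp add: B_def)
  \<comment> \<open>The factor \<open>32 * N\<close> brings the modular below \<open>B\<close>, and \<open>B + 1\<close> brings it below 1.\<close>
  define C where "C = 32 * N * (B + 1)"
  have C: "0 < C" using N B by (simp add: C_def)
  show ?thesis
  proof (intro exI[of _ C] conjI allI impI)
    fix r :: nat and \<sigma> :: real and f :: "real \<Rightarrow> complex"
    assume r: "1 \<le> r" and \<sigma>: "0 < \<sigma>" and f: "f \<in> Lvar p"
    show "f \<in> bernstein_domain r" by (rule Lvar_bernstein_domain[OF p_leb p1 f r])
    have f_leb: "f \<in> borel_measurable lebesgue" using f by (simp add: Lvar_def)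
    then obtain f' where [measurable]: "f' \<in> borel_measurable borel"
      and ff': "AE x in lebesgue. f x = f' x" by (rule borel_representative)
    define D where "D = bernstein r \<sigma> k f'"
    have Df: "bernstein r \<sigma> k f = D"
      unfolding D_def by (rule bernstein_cong_AE[OF ff' f_leb]) (auto intro: measurable_completion)
    have [measurable]: "D \<in> borel_measurable borel" unfolding D_def by (rule bernstein_measurable) measurable
    have D_leb: "D \<in> borel_measurable lebesgue" by (auto intro: measurable_completion)
    have "D \<in> Lvar p \<and> Lvar_norm p D \<le> C * Lvar_norm p f"
    proof (rule Lvar_bounded_operator[OF C D_leb p_leb p1 f])
      fix \<eta> :: real assume \<eta>: "0 < \<eta>" "modular p (\<lambda>y. f y / of_real \<eta>) < 1"
      define a where "a = (\<lambda>y. cmod (f' y / of_real \<eta>))"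
      define m where "m = (\<lambda>x. cmod (D x / of_real (32 * N * \<eta>)))"
      have [measurable]: "a \<in> borel_measurable borel" unfolding a_def by measurable
      have "modular p (\<lambda>y. f y / of_real \<eta>) = modular p (\<lambda>y. f' y / of_real \<eta>)"
        using ff' by (intro modular_cong_AE) auto
      also have "\<dots> = (\<integral>\<^sup>+ y. ennreal (a y powr p y) \<partial>lborel)"
        by (simp add: modular_def a_def nn_integral_completion)
      finally have a1: "(\<integral>\<^sup>+ y. ennreal (a y powr p y) \<partial>lborel) \<le> 1" using \<eta> by simp
      have h: "0 < bern_scale r \<sigma>" using r \<sigma> by (simp add: bern_scale_def)
      have "(\<integral>\<^sup>+ x. ennreal (m x powr p x) \<partial>lborel) \<le> ennreal (33 * exp (c1 + 4 * c2))"
      proof (rule cauchy_modular_bound[OF _ _ p1 c1 c2(1) _ s _ a1 h])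
        fix x
        let ?I = "\<lambda>g. (\<integral>\<^sup>+ u. ennreal (cauchy_kernel (bern_scale r \<sigma>) (u - x)) * ennreal (g u) \<partial>lborel)"
        have "ennreal (N * \<eta>) * ennreal (32 * m x) = ennreal (N * \<eta> * (32 * m x))"
          using N \<eta> by (intro ennreal_mult[symmetric]) (auto simp: m_def)
        also have "N * \<eta> * (32 * m x) = cmod (D x)"
          using N \<eta> by (simp add: m_def norm_divide norm_mult)
        also have "ennreal (cmod (D x)) \<le> ennreal N * ?I (\<lambda>u. cmod (f' u))"
          unfolding D_def N_def by (rule bernstein_le_cauchy[OF _ r \<sigma>]) measurable
        also have "?I (\<lambda>u. cmod (f' u)) = (\<integral>\<^sup>+ u. ennreal \<eta> *
            (ennreal (cauchy_kernel (bern_scale r \<sigma>) (u - x)) * ennreal (a u)) \<partial>lborel)"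
        proof (intro nn_integral_cong)
          fix u
          have "cmod (f' u) = \<eta> * a u" using \<eta> by (simp add: a_def norm_divide)
          then have "ennreal (cmod (f' u)) = ennreal \<eta> * ennreal (a u)"
            using \<eta> by (simp add: ennreal_mult a_def)
          then show "ennreal (cauchy_kernel (bern_scale r \<sigma>) (u - x)) * ennreal (cmod (f' u)) =
              ennreal \<eta> * (ennreal (cauchy_kernel (bern_scale r \<sigma>) (u - x)) * ennreal (a u))"
            by (simp only: mult_ac)
        qed
        also have "\<dots> = ennreal \<eta> * ?I a"
          by (rule nn_integral_cmult) measurable
        also have "ennreal N * (ennreal \<eta> * ?I a) = ennreal (N * \<eta>) * ?I a"
          using N \<eta> by (simp add: ennreal_mult mult.assoc)
        finally show "ennreal (32 * m x) \<le> ?I a"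
          using N \<eta> by (subst (asm) ennreal_mult_le_mult_iff) auto
      qed (auto simp: s_def a_def m_def)
      then have "modular p (\<lambda>x. D x / of_real (32 * N * \<eta>)) \<le> ennreal B"
        by (simp add: modular_def nn_integral_completion B_def m_def)
      then have "modular p (\<lambda>x. D x / of_real (32 * N * \<eta>) / of_real (B + 1)) < 1"
        using B D_leb by (intro modular_divide_less_one[OF p_leb _ p1]) auto
      moreover have "D x / of_real (32 * N * \<eta>) / of_real (B + 1) = D x / of_real (C * \<eta>)" for x
        by (simp add: C_def mult_ac)
      ultimately show "modular p (\<lambda>x. D x / of_real (C * \<eta>)) < 1" by (simp only:)
    qed
    then show "bernstein r \<sigma> k f \<in> Lvar p" "Lvar_norm p (bernstein r \<sigma> k f) \<le> C * Lvar_norm p f"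
      by (simp_all add: Df)
  qed (rule C)
qed

end
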